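(* Let $\mathbb{F}_q$ be a finite field with $\mathrm{char}(\mathbb{F}_q)>3$ and $3\mid q-1$. Then $\mathfrak{sl}_3(\mathbb{F}_q)$ has a unique COD up to conjugacy, represented by $J_3(1,1)$.
   Context: $\mathfrak{sl}_n(\mathbb{F})$ denotes the Lie algebra of $n\times n$ traceless matrices over $\mathbb{F}$. A Cartan subalgebra is a nilpotent self-normalizing subalgebra. A classical Cartan subalgebra of $\mathfrak{L}=\mathfrak{sl}_n(\mathbb{F})$ (with $\ell=\mathrm{char}\,\mathbb{F}$) is an abelian Cartan subalgebra $H$ such that: (a) $\mathfrak{L}=\bigoplus_\alpha \mathfrak{L}_\alpha$ with $\mathfrak{L}_\alpha=\{x: [x,h]=\alpha(h)x\ \forall h\in H\}$ over linear functionals $\alpha$ on $H$ (roots); (b) for each root $\alpha\ne0$, $[\mathfrak{L}_\alpha,\mathfrak{L}_{-\alpha}]$ is one-dimensional; (c) for roots $\alpha,\beta$ with $\beta\neq0$, not all $\alpha+k\beta$ ($1\le k\le \ell-1$) are roots. The Killing form is $K(A,B)=2n\,\mathrm{Tr}(AB)$. A COD of $\mathfrak{sl}_n(\mathbb{F})$ is a vector space decomposition $\mathfrak{sl}_n(\mathbb{F})=H_0\oplus\cdots\oplus H_n$ into classical Cartan subalgebras that are pairwise orthogonal with respect to $K$. Two CODs are conjugate if there is a Lie algebra automorphism of $\mathfrak{sl}_n(\mathbb{F})$ mapping each component of the first decomposition onto exactly one component of the second. Fix a primitive cube root of unity $u\in\mathbb{F}_q$; $J_3(1,1)$ denotes the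 decomposition $\mathfrak{sl}_3(\mathbb{F}_q)=H_0\oplus H_1\oplus H_2\oplus H_3$ where $H_0$ is the traceless diagonal matrices and, for $j=1,2,3$ with $(\lambda_j,\mu_j)=(1,1),(u,u^2),(u^2,u)$, $H_j=\left\langle \begin{pmatrix}0&1&0\\0&0&\lambda_j\\ \mu_j&0&0\end{pmatrix},\begin{pmatrix}0&0&1\\ \mu_j&0&0\\0&\lambda_j&0\end{pmatrix}\right\rangle_{\mathbb{F}_q}$. *)

theory Defs
  imports "HOL-Analysis.Analysis" "HOL-Library.Numeral_Type"
begin

type_synonym 'a m3 = "'a^3^3"

definition sl3 :: "('a::field) m3 set" where
  "sl3 = {A. trace A = 0}"

definition brk :: "('a::field) m3 \<Rightarrow> 'a m3 \<Rightarrow> 'a m3" where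
  "brk A B = A ** B - B ** A"

definition smul :: "'a::field \<Rightarrow> 'a m3 \<Rightarrow> 'a m3" where
  "smul c A = (\<chi> i j. c * A $ i $ j)"

text \<open>Killing form of sl_n with n = 3: K(A,B) = 2n Tr(AB).\<close>
definition killing :: "('a::field) m3 \<Rightarrow> 'a m3 \<Rightarrow> 'a" where
  "killing A B = 6 * trace (A ** B)"

definition lsubspace :: "('a::field) m3 set \<Rightarrow> bool" where
  "lsubspace V \<longleftrightarrow> 0 \<in> V \<and> (\<forall>x\<in>V. \<forall>y\<in>V. x + y \<in> V) \<and> (\<forall>c. \<forall>x\<in>V. smul c x \<in> V)"

definition lspan :: "('a::field) m3 set \<Rightarrow> 'a m3 set" where
  "lspan S = {x. \<exists>T c. finite T \<and> T \<subseteq> S \<and> x = (\<Sum>t\<in>T. smul (c t) t)}"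

definition one_dimensional :: "('a::field) m3 set \<Rightarrow> bool" where
  "one_dimensional V \<longleftrightarrow> (\<exists>v. v \<noteq> 0 \<and> V = {smul c v | c. True})"

definition subalgebra :: "('a::field) m3 set \<Rightarrow> bool" where
  "subalgebra H \<longleftrightarrow> H \<subseteq> sl3 \<and> lsubspace H \<and> (\<forall>x\<in>H. \<forall>y\<in>H. brk x y \<in> H)"

text \<open>Nilpotent: some k-fold iterated bracket of elements of H vanishes identically
  (i.e. the lower central series of H reaches 0).\<close>
definition nilpotent_alg :: "('a::field) m3 set \<Rightarrow> bool" where
  "nilpotent_alg H \<longleftrightarrow> (\<exists>k. \<forall>xs y. length xs = k \<and> set xs \<subseteq> H \<and> y \<in> H \<longrightarrow> foldr brk xs y = 0)"

definition normalizer :: "('a::field) m3 set \<Rightarrow> 'a m3 set" where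
  "normalizer H = {x \<in> sl3. \<forall>h\<in>H. brk x h \<in> H}"

definition cartan :: "('a::field) m3 set \<Rightarrow> bool" where
  "cartan H \<longleftrightarrow> subalgebra H \<and> nilpotent_alg H \<and> normalizer H = H"

definition abelian :: "('a::field) m3 set \<Rightarrow> bool" where
  "abelian H \<longleftrightarrow> (\<forall>x\<in>H. \<forall>y\<in>H. brk x y = 0)"

text \<open>Linear functionals on H, represented as functions vanishing outside H
  (so that two functionals are equal iff they agree on H).\<close>
definition lin_functional :: "('a::field) m3 set \<Rightarrow> ('a m3 \<Rightarrow> 'a) \<Rightarrow> bool" where
  "lin_functional H \<alpha> \<longleftrightarrow> (\<forall>x\<in>H. \<forall>y\<in>H. \<alpha> (x + y) = \<alpha> x + \<alpha> y)
     \<and> (\<forall>c. \<forall>x\<in>H. \<alpha> (smul c x) = c * \<alpha> x) \<and> (\<forall>x. x \<notin> H \<longrightarrow> \<alpha> x = 0)"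

definition root_space :: "('a::field) m3 set \<Rightarrow> ('a m3 \<Rightarrow> 'a) \<Rightarrow> 'a m3 set" where
  "root_space H \<alpha> = {x \<in> sl3. \<forall>h\<in>H. brk x h = smul (\<alpha> h) x}"

definition is_root :: "('a::field) m3 set \<Rightarrow> ('a m3 \<Rightarrow> 'a) \<Rightarrow> bool" where
  "is_root H \<alpha> \<longleftrightarrow> lin_functional H \<alpha> \<and> root_space H \<alpha> \<noteq> {0}"

definition classical_cartan :: "('a::field) m3 set \<Rightarrow> bool" where
  "classical_cartan H \<longleftrightarrow> cartan H \<and> abelian H
   \<comment> \<open>(a) sl_3 is the direct sum of the root spaces\<close>
   \<and> (\<forall>x\<in>sl3. \<exists>S f. finite S \<and> (\<forall>\<alpha>\<in>S. is_root H \<alpha> \<and> f \<alpha> \<in> root_space H \<alpha>)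
                     \<and> x = (\<Sum>\<alpha>\<in>S. f \<alpha>))
   \<and> (\<forall>S f. finite S \<and> (\<forall>\<alpha>\<in>S. is_root H \<alpha> \<and> f \<alpha> \<in> root_space H \<alpha>)
            \<and> (\<Sum>\<alpha>\<in>S. f \<alpha>) = 0 \<longrightarrow> (\<forall>\<alpha>\<in>S. f \<alpha> = 0))
   \<comment> \<open>(b)\<close>
   \<and> (\<forall>\<alpha>. is_root H \<alpha> \<and> \<alpha> \<noteq> (\<lambda>_. 0) \<longrightarrow>
        one_dimensional (lspan {brk x y | x y. x \<in> root_space H \<alpha> \<and> y \<in> root_space H (\<lambda>h. - \<alpha> h)}))
   \<comment> \<open>(c)\<close>
   \<and> (\<forall>\<alpha> \<beta>. is_root H \<alpha> \<and> is_root H \<beta> \<and> \<beta> \<noteq> (\<lambda>_. 0) \<longrightarrow>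
        \<not> (\<forall>k. 1 \<le> k \<and> k \<le> CHAR('a) - 1 \<longrightarrow> is_root H (\<lambda>h. \<alpha> h + of_nat k * \<beta> h)))"

definition is_COD :: "(nat \<Rightarrow> ('a::field) m3 set) \<Rightarrow> bool" where
  "is_COD H \<longleftrightarrow> (\<forall>i\<le>3. classical_cartan (H i))
   \<and> (\<forall>i\<le>3. \<forall>j\<le>3. i \<noteq> j \<longrightarrow> (\<forall>x\<in>H i. \<forall>y\<in>H j. killing x y = 0))
   \<and> (\<forall>x\<in>sl3. \<exists>h. (\<forall>i\<le>3. h i \<in> H i) \<and> x = (\<Sum>i\<le>3. h i))
   \<and> (\<forall>h. (\<forall>i\<le>3. h i \<in> H i) \<and> (\<Sum>i\<le>3. h i) = 0 \<longrightarrow> (\<forall>i\<le>3. h i = 0))"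

definition lie_automorphism :: "(('a::field) m3 \<Rightarrow> 'a m3) \<Rightarrow> bool" where
  "lie_automorphism \<phi> \<longleftrightarrow> bij_betw \<phi> sl3 sl3
   \<and> (\<forall>x\<in>sl3. \<forall>y\<in>sl3. \<phi> (x + y) = \<phi> x + \<phi> y)
   \<and> (\<forall>c. \<forall>x\<in>sl3. \<phi> (smul c x) = smul c (\<phi> x))
   \<and> (\<forall>x\<in>sl3. \<forall>y\<in>sl3. \<phi> (brk x y) = brk (\<phi> x) (\<phi> y))"

definition COD_conjugate :: "(nat \<Rightarrow> ('a::field) m3 set) \<Rightarrow> (nat \<Rightarrow> 'a m3 set) \<Rightarrow> bool" where
  "COD_conjugate H H' \<longleftrightarrow> (\<exists>\<phi> \<sigma>. lie_automorphism \<phi> \<and>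
      (\<forall>i\<le>3. \<sigma> i \<le> 3 \<and> \<phi> ` H i = H' (\<sigma> i)))"

definition mat3 :: "'a \<Rightarrow> 'a \<Rightarrow> 'a \<Rightarrow> 'a \<Rightarrow> 'a \<Rightarrow> 'a \<Rightarrow> 'a \<Rightarrow> 'a \<Rightarrow> 'a \<Rightarrow> 'a^3^3" where
  "mat3 a11 a12 a13 a21 a22 a23 a31 a32 a33 = (\<chi> i j.
     if i = 0 then (if j = 0 then a11 else if j = 1 then a12 else a13)
     else if i = 1 then (if j = 0 then a21 else if j = 1 then a22 else a23)
     else (if j = 0 then a31 else if j = 1 then a32 else a33))"

text \<open>The decomposition J_3(1,1) for a fixed primitive cube root of unity u.\<close>
definition J3 :: "'a::field \<Rightarrow> nat \<Rightarrow> 'a m3 set" where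
  "J3 u k = (if k = 0 then {A \<in> sl3. \<forall>i j. i \<noteq> j \<longrightarrow> A $ i $ j = 0}
     else let (l, m) = (if k = 1 then (1, 1) else if k = 2 then (u, u^2) else (u^2, u)) in
       {smul a (mat3 0 1 0 0 0 l m 0 0) + smul b (mat3 0 0 1 m 0 0 0 l 0) | a b. True})"

end

theory Submission
  imports Defs
begin

text \<open>A root vector of a classical Cartan subalgebra \<open>H\<close> for a nonzero root has traceless powers, hence is
nilpotent, and it or its square has rank one; its row space is then a common row eigenvector \<open>w\<close>
of \<open>H\<close>. As scalars and root vectors span all matrices, the rows \<open>w A\<close> with \<open>A\<close> a scalar or a
root vector span all row vectors, and they are common eigenvectors as well. So \<open>H\<close> is conjugate to
the diagonal subalgebra. Given a COD, make \<open>H 0\<close> diagonal. Every other component is spanned by \<open>A\<close>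
and \<open>A\<^sup>2\<close> with \<open>A\<^sup>3 = 1\<close>, and orthogonality to \<open>H 0\<close> makes both zero on the diagonal, so \<open>A\<close> or
\<open>A\<^sup>2\<close> is a weighted cyclic permutation matrix with weights \<open>a, d, e\<close> where \<open>a d e = 1\<close>. A diagonal
conjugation normalizes \<open>H 1\<close> to weights \<open>1, 1, 1\<close>; orthogonality to it forces \<open>a + d + e = 0\<close> and
\<open>a d + d e + e a = 0\<close>, so the remaining weights are proportional to \<open>1, u, u\<^sup>2\<close> or \<open>1, u\<^sup>2, u\<close>.\<close>

section \<open>Matrices of size three and conjugation by an invertible matrix\<close>

lemma three_eq_zero_index: "(3::3) = 0"
  by (simp add: bit1.of_int_eq)

text \<open>Rows and columns are numbered 0, 1, 2 as in \<open>mat3\<close>, so the enumeration 1,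
  2, 3 of the index type is rewritten with \<open>3 = 0\<close>.\<close>

lemma forall_index3: "(\<forall>i::3. P i) \<longleftrightarrow> P 0 \<and> P 1 \<and> P 2"
  unfolding forall_3 three_eq_zero_index by auto

lemma sum_index3: "sum f (UNIV :: 3 set) = f 0 + f 1 + f 2"
  by (simp add: sum_3 three_eq_zero_index ac_simps)

lemmas mat_entries = vec_eq_iff forall_index3 sum_index3 matrix_matrix_mult_def trace_def smul_def mat3_def mat_def

lemma smul_nth [simp]: "smul c A $ i $ j = c * A $ i $ j"
  by (simp add: smul_def)

lemma matrix_mult_nth3: "(A ** B) $ i $ j = A $ i $ 0 * B $ 0 $ j + A $ i $ 1 * B $ 1 $ j + A $ i $ 2 * B $ 2 $ j"
  for A B :: "'a::semiring_1 m3"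
  by (simp add: matrix_matrix_mult_def sum_index3)

lemma smul_mult_left: "smul c A ** B = smul c (A ** B)" and smul_mult_right: "A ** smul c B = smul c (A ** B)"
  for A B :: "'a::field m3"
  by (simp_all add: mat_entries algebra_simps)

lemma smul_zero [simp]: "smul c 0 = 0"
  and smul_smul: "smul c (smul d A) = smul (c * d) A"
  and smul_zero_left [simp]: "smul 0 A = 0"
  and smul_one [simp]: "smul 1 A = A"
  and smul_add_left: "smul (c + d) A = smul c A + smul d A"
  by (simp_all add: vec_eq_iff algebra_simps)

lemma trace_smul: "trace (smul c A) = c * trace A"
  by (simp add: trace_def sum_distrib_left)

lemma matrix_diff_ldistrib3: "A ** (B - C) = A ** B - A ** C"
  and matrix_diff_rdistrib3: "(B - C) ** A = B ** A - C ** A"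
  for A B C :: "'a::field m3"
  by (simp_all add: mat_entries algebra_simps)

lemma matrix_add_rdistrib3: "(B + C) ** A = B ** A + C ** A"
  for A B C :: "'a::field m3"
  by (simp add: mat_entries algebra_simps)

lemma matrix_zero_mult [simp]: "A ** 0 = 0" "0 ** A = 0" for A :: "'a::field m3"
  by (simp_all add: mat_entries)

text \<open>\<open>Q\<close> stands for the inverse of \<open>P\<close>; as a separate argument it
  lets the laws below rest on the single equation \<open>Q ** P = mat 1\<close>.\<close>

definition conj3 :: "'a::field m3 \<Rightarrow> 'a m3 \<Rightarrow> 'a m3 \<Rightarrow> 'a m3" where
  "conj3 P Q x = P ** x ** Q"

lemma conj3_add: "conj3 P Q (x + y) = conj3 P Q x + conj3 P Q y"
  by (simp add: conj3_def matrix_add_ldistrib matrix_add_rdistrib3)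

lemma conj3_zero [simp]: "conj3 P Q 0 = 0"
  by (simp add: conj3_def)

lemma conj3_smul: "conj3 P Q (smul c x) = smul c (conj3 P Q x)"
  by (simp add: conj3_def smul_mult_left smul_mult_right)

lemma conj3_sum: "conj3 P Q (sum f S) = (\<Sum>s\<in>S. conj3 P Q (f s))"
  by (induction S rule: infinite_finite_induct) (simp_all add: conj3_add)

lemma conj3_inverse:
  assumes "Q ** P = mat 1"
  shows "conj3 Q P (conj3 P Q x) = x"
proof -
  have "conj3 Q P (conj3 P Q x) = (Q ** P) ** x ** (Q ** P)"
    by (simp add: conj3_def matrix_mul_assoc)
  then show ?thesis by (simp add: assms)
qed

lemma conj3_mult:
  assumes "Q ** P = mat 1"
  shows "conj3 P Q (x ** y) = conj3 P Q x ** conj3 P Q y"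
proof -
  have "conj3 P Q x ** conj3 P Q y = P ** x ** (Q ** P) ** y ** Q"
    by (simp add: conj3_def matrix_mul_assoc)
  then show ?thesis by (simp add: assms conj3_def matrix_mul_assoc)
qed

lemma conj3_brk:
  assumes "Q ** P = mat 1"
  shows "conj3 P Q (brk x y) = brk (conj3 P Q x) (conj3 P Q y)"
  by (simp add: brk_def conj3_mult[OF assms, symmetric])
     (simp add: conj3_def matrix_diff_ldistrib3 matrix_diff_rdistrib3)

lemma trace_conj3:
  assumes "Q ** P = mat 1"
  shows "trace (conj3 P Q x) = trace x"
proof -
  have "trace (conj3 P Q x) = trace (Q ** (P ** x))"
    unfolding conj3_def by (rule trace_mul_sym)
  then show ?thesis by (simp add: assms matrix_mul_assoc)
qed

lemma conj3_mem_sl3 [simp]: "Q ** P = mat 1 \<Longrightarrow> conj3 P Q x \<in> sl3 \<longleftrightarrow> x \<in> sl3"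
  by (simp add: sl3_def trace_conj3)

lemma killing_conj3:
  assumes "Q ** P = mat 1"
  shows "killing (conj3 P Q x) (conj3 P Q y) = killing x y"
  by (simp add: killing_def trace_conj3[OF assms] conj3_mult[OF assms, symmetric])

text \<open>All automorphisms in the uniqueness proof are of this form. The inverse map is
  conjugation with \<open>P\<close> and \<open>Q\<close> exchanged.\<close>

lemma lie_automorphism_conj3:
  assumes "Q ** P = mat 1"
  shows "lie_automorphism (conj3 P Q)"
proof -
  have PQ: "P ** Q = mat 1" using assms by (simp add: matrix_left_right_inverse)
  have "bij_betw (conj3 P Q) sl3 sl3"
    by (rule bij_betwI[where g = "conj3 Q P"]) (auto simp: assms PQ conj3_inverse)
  then show ?thesis
    by (simp add: lie_automorphism_def conj3_add conj3_smul conj3_brk assms)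
qed

definition diag3 :: "'a::field m3 set" where
  "diag3 = {A \<in> sl3. \<forall>i j. i \<noteq> j \<longrightarrow> A $ i $ j = 0}"

lemma mem_sl3: "A \<in> sl3 \<longleftrightarrow> A $ 0 $ 0 + A $ 1 $ 1 + A $ 2 $ 2 = 0"
  by (simp add: sl3_def trace_def sum_index3)

lemma zero_mem_sl3: "0 \<in> sl3"
  by (simp add: mem_sl3)

subsection \<open>Simultaneous diagonalization\<close>

text \<open>The trace conditions give \<open>e\<^sup>2 = adj e\<close> and \<open>det e = 0\<close>, and the \<open>2 \<times> 2\<close> minors of \<open>adj e\<close> are
the multiples of \<open>det e\<close> by the entries of \<open>e\<close>.\<close>
lemma minors_vanish:
  fixes e :: "'a::field m3"
  assumes two: "(2::'a) \<noteq> 0" and three: "(3::'a) \<noteq> 0"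
    and t1: "trace e = 0" and t2: "trace (e ** e) = 0" and t3: "trace (e ** e ** e) = 0"
    and r: "r = (if e ** e = 0 then e else e ** e)"
  shows "r $ i $ j * r $ k $ l = r $ i $ l * r $ k $ j"
proof -
  define a b c d f g h m n where
    "a = e $ 0 $ 0" "b = e $ 0 $ 1" "c = e $ 0 $ 2"
    "d = e $ 1 $ 0" "f = e $ 1 $ 1" "g = e $ 1 $ 2"
    "h = e $ 2 $ 0" "m = e $ 2 $ 1" "n = e $ 2 $ 2"
  note defs = this
  have T: "a + f + n = 0"
    using t1 by (simp add: mat_entries defs)
  \<comment> \<open>Newton's identity: the factor after 2 is the sum of the principal 2 x 2 minors,
    the second coefficient of the characteristic polynomial.\<close>
  have "2 * (a * f - b * d + a * n - c * h + f * n - g * m) = (a + f + n)^2 - trace (e ** e)"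
    by (simp add: mat_entries defs algebra_simps power2_eq_square)
  then have C: "a * f - b * d + a * n - c * h + f * n - g * m = 0"
    using T t2 two by (metis diff_zero mult_eq_0_iff power_zero_numeral)
  define D where "D = a * f * n + b * g * h + c * d * m - a * g * m - b * d * n - c * f * h"
  \<comment> \<open>Newton's identity for the determinant \<open>D\<close>, in terms of the power
    traces.\<close>
  have "3 * D = trace (e ** e ** e) - (a + f + n) ^ 3 + 3 * (a + f + n) * (a * f - b * d + a * n - c * h + f * n - g * m)"
    by (simp add: mat_entries defs D_def algebra_simps power3_eq_cube)
  then have D: "a * f * n + b * g * h + c * d * m - a * g * m - b * d * n - c * f * h = 0"
    using T C t3 three by (simp flip: D_def)
  have E: "(e ** e) $ 0 $ 0 = f * n - g * m" "(e ** e) $ 0 $ 1 = c * m - b * n" "(e ** e) $ 0 $ 2 = b * g - c * f"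
    "(e ** e) $ 1 $ 0 = g * h - d * n" "(e ** e) $ 1 $ 1 = a * n - c * h" "(e ** e) $ 1 $ 2 = c * d - a * g"
    "(e ** e) $ 2 $ 0 = d * m - f * h" "(e ** e) $ 2 $ 1 = b * h - a * m" "(e ** e) $ 2 $ 2 = a * f - b * d"
    unfolding matrix_mult_nth3 defs[symmetric] using T C by algebra+
  have "\<forall>i j k l. r $ i $ j * r $ k $ l = r $ i $ l * r $ k $ j"
  proof (cases "e ** e = 0")
    case True
    have "r = e" using r True by simp
    \<comment> \<open>The adjugate \<open>e ** e\<close> is zero here, so all 2 x 2 minors of
      \<open>e\<close> itself vanish.\<close>
    have F: "f * n = g * m" "c * m = b * n" "b * g = c * f" "g * h = d * n" "a * n = c * h"
      "c * d = a * g" "d * m = f * h" "b * h = a * m" "a * f = b * d"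
      using E by (simp_all add: True)
    show ?thesis
      unfolding forall_index3 \<open>r = e\<close> defs[symmetric]
      by (intro conjI; (rule refl | rule mult.commute | metis F mult.commute))
  next
    case False
    have "r = e ** e" using r False by simp
    show ?thesis
      unfolding forall_index3 \<open>r = e ** e\<close> E
      by (insert D, intro conjI; (rule refl | rule mult.commute | algebra))
  qed
  then show ?thesis by simp
qed

lemma brk_eq_iff: "brk x h = smul c x \<longleftrightarrow> x ** h = h ** x + smul c x"
  by (auto simp: brk_def algebra_simps)

text \<open>All rows of \<open>r\<close> are multiples of row \<open>i\<close>, hence so are all
  rows of \<open>h ** r\<close>. The relation \<open>r ** h = h ** r + smul c r\<close>, read in row
  \<open>i\<close>, is then an eigenvector equation.\<close>

lemma row_eigenvector_of_rank_one:
  fixes r h :: "'a::field m3"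
  assumes minors: "\<And>i j k l. r $ i $ j * r $ k $ l = r $ i $ l * r $ k $ j"
    and nz: "r $ i $ j \<noteq> 0" and brk: "brk r h = smul c r"
  shows "\<exists>d. (r $ i) v* h = d *s (r $ i)"
proof
  let ?q = "\<lambda>k. r $ k $ j / r $ i $ j"
  have row: "r $ k $ l = ?q k * r $ i $ l" for k l
    using minors[of i j k l] nz by (simp add: field_simps)
  have "(r ** h) $ i $ l = (h ** r) $ i $ l + c * r $ i $ l" for l
    using brk by (simp add: brk_eq_iff)
  moreover have "(h ** r) $ i $ l = (h $ i $ 0 * ?q 0 + h $ i $ 1 * ?q 1 + h $ i $ 2 * ?q 2) * r $ i $ l" for l
    unfolding matrix_mult_nth3 using row[of 0 l] row[of 1 l] row[of 2 l]
    by (simp add: distrib_right mult.assoc)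
  moreover have "((r $ i) v* h) $ l = (r ** h) $ i $ l" for l
    by (simp add: vector_matrix_mult_def matrix_matrix_mult_def)
  ultimately show "(r $ i) v* h = (h $ i $ 0 * ?q 0 + h $ i $ 1 * ?q 1 + h $ i $ 2 * ?q 2 + c) *s (r $ i)"
    by (simp only: vec_eq_iff vector_smult_component distrib_right simp_thms)
qed

lemma classical_cartanD:
  assumes "classical_cartan H"
  shows "subalgebra H" "normalizer H = H" "0 \<in> H" "\<And>x y. x \<in> H \<Longrightarrow> y \<in> H \<Longrightarrow> brk x y = 0"
proof -
  have c: "cartan H" "abelian H"
    using assms unfolding classical_cartan_def by (rule conjunct1, rule conjunct1[OF conjunct2])
  show "subalgebra H" "normalizer H = H" using c by (simp_all add: cartan_def)
  then show "0 \<in> H" by (simp add: subalgebra_def lsubspace_def)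
  show "\<And>x y. x \<in> H \<Longrightarrow> y \<in> H \<Longrightarrow> brk x y = 0" using c(2) by (simp add: abelian_def)
qed

lemma classical_cartan_decompose:
  assumes "classical_cartan H" "x \<in> sl3"
  obtains S f where "finite S" "\<And>\<alpha>. \<alpha> \<in> S \<Longrightarrow> is_root H \<alpha>" "\<And>\<alpha>. \<alpha> \<in> S \<Longrightarrow> f \<alpha> \<in> root_space H \<alpha>"
    "x = (\<Sum>\<alpha>\<in>S. f \<alpha>)"
proof -
  have "\<forall>x\<in>sl3. \<exists>S f. finite S \<and> (\<forall>\<alpha>\<in>S. is_root H \<alpha> \<and> f \<alpha> \<in> root_space H \<alpha>) \<and> x = (\<Sum>\<alpha>\<in>S. f \<alpha>)"
    using assms(1) unfolding classical_cartan_def by (elim conjE)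
  from bspec[OF this assms(2)] show ?thesis
    using that by metis
qed

text \<open>If every root vanished on \<open>H\<close>, all of \<open>sl3\<close> would commute with
  \<open>H\<close> and so lie in its normalizer \<open>H\<close>, making \<open>sl3\<close>
  abelian.\<close>

lemma nonzero_root_vector:
  assumes H: "classical_cartan (H :: 'a::field m3 set)"
  obtains \<alpha> e h where "e \<in> root_space H \<alpha>" "e \<noteq> 0" "h \<in> H" "\<alpha> h \<noteq> 0"
proof -
  have "\<exists>\<alpha> h. is_root H \<alpha> \<and> h \<in> H \<and> \<alpha> h \<noteq> 0"
  proof (rule ccontr)
    assume "\<not> ?thesis"
    then have zero: "\<alpha> h = 0" if "is_root H \<alpha>" "h \<in> H" for \<alpha> h
      using that by blast
    have "brk x h = 0" if "x \<in> sl3" "h \<in> H" for x h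
    proof -
      obtain S f where S: "finite S" "\<And>\<alpha>. \<alpha> \<in> S \<Longrightarrow> is_root H \<alpha>"
        "\<And>\<alpha>. \<alpha> \<in> S \<Longrightarrow> f \<alpha> \<in> root_space H \<alpha>" "x = (\<Sum>\<alpha>\<in>S. f \<alpha>)"
        using classical_cartan_decompose[OF H \<open>x \<in> sl3\<close>] by blast
      have "brk (f \<alpha>) h = 0" if "\<alpha> \<in> S" for \<alpha>
        using S(3)[OF that] zero[OF S(2)[OF that] \<open>h \<in> H\<close>] \<open>h \<in> H\<close> by (simp add: root_space_def)
      moreover have "brk (\<Sum>\<alpha>\<in>S. f \<alpha>) h = (\<Sum>\<alpha>\<in>S. brk (f \<alpha>) h)"
        using S(1) by induction (simp_all add: brk_def matrix_add_ldistrib matrix_add_rdistrib3)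
      ultimately show ?thesis
        by (simp add: S(4))
    qed
    then have "sl3 \<subseteq> normalizer H"
      using classical_cartanD(3)[OF H] by (simp add: normalizer_def subset_iff)
    then have "brk x y = 0" if "x \<in> sl3" "y \<in> sl3" for x y :: "'a m3"
      using that classical_cartanD(2,4)[OF H] by blast
    \<comment> \<open>Two opposite matrix units, whose bracket has entry 1 at position
      \<open>(0, 0)\<close>.\<close>
    from this[of "mat3 0 1 0 0 0 0 0 0 0" "mat3 0 0 0 1 0 0 0 0 0"]
    have "brk (mat3 0 1 0 0 0 0 0 0 0) (mat3 0 0 0 1 0 0 0 0 0) $ 0 $ 0 = (0::'a)"
      by (simp add: mem_sl3 mat3_def)
    then show False
      by (simp add: brk_def matrix_mult_nth3 mat3_def)
  qed
  then obtain \<alpha> h where \<alpha>: "is_root H \<alpha>" "h \<in> H" "\<alpha> h \<noteq> 0" by blast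
  have "0 \<in> root_space H \<alpha>"
    by (simp add: root_space_def mem_sl3 brk_def)
  then obtain e where "e \<in> root_space H \<alpha>" "e \<noteq> 0"
    using \<alpha>(1) by (auto simp: is_root_def)
  then show ?thesis using \<alpha> that by blast
qed

text \<open>Commuting \<open>e\<close>, \<open>e^2\<close>, \<open>e^3\<close> past \<open>h\<close>
  adds \<open>\<alpha> h\<close>, \<open>2 * \<alpha> h\<close>, \<open>3 * \<alpha> h\<close> times
  the power. A commutator has trace 0, so choosing \<open>\<alpha> h \<noteq> 0\<close> makes all
  three powers traceless. By \<open>minors_vanish\<close>, \<open>e\<close> or \<open>e ** e\<close>
  has rank one, and a nonzero row of it serves as \<open>w\<close>.\<close>

lemma ex_row_eigenvector:
  assumes H: "classical_cartan (H :: 'a::field m3 set)"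
    and two: "(2::'a) \<noteq> 0" and three: "(3::'a) \<noteq> 0"
  obtains w where "w \<noteq> 0" "\<And>h. h \<in> H \<Longrightarrow> \<exists>c. w v* h = c *s w"
proof -
  obtain \<alpha> e h where e: "e \<in> root_space H \<alpha>" "e \<noteq> 0" "h \<in> H" "\<alpha> h \<noteq> 0"
    using nonzero_root_vector[OF H] .
  have b1: "e ** h = h ** e + smul (\<alpha> h) e" if "h \<in> H" for h
    using e(1) that by (auto simp: root_space_def brk_eq_iff)
  have b2: "(e ** e) ** h = h ** (e ** e) + smul (2 * \<alpha> h) (e ** e)" if "h \<in> H" for h
  proof -
    have "(e ** e) ** h = e ** (e ** h)" by (simp add: matrix_mul_assoc)
    also have "\<dots> = (e ** h) ** e + smul (\<alpha> h) (e ** e)"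
      unfolding b1[OF that] by (simp add: matrix_add_ldistrib matrix_add_rdistrib3 smul_mult_left smul_mult_right matrix_mul_assoc b1[OF that])
    also have "\<dots> = h ** (e ** e) + smul (2 * \<alpha> h) (e ** e)"
      by (simp add: b1[OF that] matrix_add_rdistrib3 smul_mult_left matrix_mul_assoc vec_eq_iff)
    finally show ?thesis .
  qed
  have b3: "(e ** e ** e) ** h = h ** (e ** e ** e) + smul (3 * \<alpha> h) (e ** e ** e)" if "h \<in> H" for h
  proof -
    have "(e ** e ** e) ** h = (e ** e) ** (e ** h)" by (simp add: matrix_mul_assoc)
    also have "\<dots> = ((e ** e) ** h) ** e + smul (\<alpha> h) (e ** e ** e)"
      unfolding b1[OF that] by (simp add: matrix_add_ldistrib smul_mult_right matrix_mul_assoc)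
    also have "\<dots> = h ** (e ** e ** e) + smul (3 * \<alpha> h) (e ** e ** e)"
      by (simp add: b2[OF that] matrix_add_rdistrib3 smul_mult_left matrix_mul_assoc vec_eq_iff)
    finally show ?thesis .
  qed
  have traceless: "trace x = 0" if "x ** h = h ** x + smul c x" "c \<noteq> 0" for x c
  proof -
    have "trace (x ** h) = trace (h ** x) + c * trace x"
      using that(1) by (simp add: trace_add trace_smul)
    then show ?thesis using that(2) by (simp add: trace_mul_sym[of x h])
  qed
  have t: "trace e = 0" "trace (e ** e) = 0" "trace (e ** e ** e) = 0"
    using traceless[OF b1[OF e(3)]] traceless[OF b2[OF e(3)]] traceless[OF b3[OF e(3)]] e(4) two three
    by auto
  define r where "r = (if e ** e = 0 then e else e ** e)"
  have minors: "r $ i $ j * r $ k $ l = r $ i $ l * r $ k $ j" for i j k l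
    by (rule minors_vanish[OF two three t r_def])
  have r: "\<exists>c. brk r h = smul c r" if "h \<in> H" for h
    using b1[OF that] b2[OF that] by (auto simp: r_def brk_eq_iff)
  have "r \<noteq> 0" using e(2) by (simp add: r_def)
  then obtain i j where ij: "r $ i $ j \<noteq> 0" by (auto simp: vec_eq_iff)
  show ?thesis
  proof
    show "r $ i \<noteq> 0" using ij by auto
    show "\<exists>c. (r $ i) v* h = c *s (r $ i)" if "h \<in> H" for h
      using r[OF that] row_eigenvector_of_rank_one[OF minors ij] by blast
  qed
qed

lemma vector_matrix_mult_sum: "w v* (\<Sum>s\<in>S. f s) = (\<Sum>s\<in>S. w v* f s)"
  for f :: "'b \<Rightarrow> 'a::field m3"
  by (induction S rule: infinite_finite_induct) (simp_all add: vector_matrix_mult_add_rdistrib)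

lemma vector_matrix_mult_smul: "w v* smul c x = c *s (w v* x)"
  by (simp add: vec_eq_iff vector_matrix_mult_def sum_distrib_left ac_simps)

text \<open>Multiplying a common row eigenvector by a root vector for \<open>\<alpha>\<close> gives
  a common eigenvector again, possibly zero, with eigenvalue shifted by
  \<open>\<alpha> h\<close>.\<close>

lemma row_eigenvectors_span:
  assumes H: "classical_cartan (H :: 'a::field m3 set)"
    and two: "(2::'a) \<noteq> 0" and three: "(3::'a) \<noteq> 0"
  shows "vec.span {y. \<forall>h\<in>H. \<exists>c. y v* h = c *s y} = UNIV"
proof -
  let ?E = "{y. \<forall>h\<in>H. \<exists>c. y v* h = c *s y}"
  obtain w where w: "w \<noteq> 0" "\<And>h. h \<in> H \<Longrightarrow> \<exists>c. w v* h = c *s w"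
    using ex_row_eigenvector[OF H two three] by blast
  obtain i where i: "w $ i \<noteq> 0" using w(1) by (auto simp: vec_eq_iff)
  have "y \<in> vec.span ?E" for y
  proof -
    \<comment> \<open>Only row \<open>i\<close> of \<open>A\<close> is nonzero, and it is scaled so
      that \<open>w v* A = y\<close>.\<close>
    define A where "A = (\<chi> k l. if k = i then y $ l / w $ i else 0)"
    have y: "w v* A = y"
      using i by (simp add: A_def vec_eq_iff vector_matrix_mult_def if_distrib cong: if_cong)
    \<comment> \<open>Subtracting the scalar part, which merely rescales \<open>w\<close>, leaves a
      traceless matrix to which the root space decomposition applies.\<close>
    define X where "X = A - smul (trace A / 3) (mat 1)"
    have "trace (mat 1 :: 'a m3) = 3"
      by (simp add: mat_entries)
    then have "X \<in> sl3"
      using three by (simp add: X_def sl3_def trace_sub trace_smul)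
    then obtain S f where S: "finite S" "\<And>\<alpha>. \<alpha> \<in> S \<Longrightarrow> f \<alpha> \<in> root_space H \<alpha>" "X = (\<Sum>\<alpha>\<in>S. f \<alpha>)"
      using classical_cartan_decompose[OF H] by metis
    have "A = smul (trace A / 3) (mat 1) + X" by (simp add: X_def)
    then have "w v* A = (trace A / 3) *s w + (\<Sum>\<alpha>\<in>S. w v* f \<alpha>)"
      by (metis S(3) vector_matrix_mul_rid vector_matrix_mult_add_rdistrib vector_matrix_mult_smul vector_matrix_mult_sum)
    moreover have "w v* f \<alpha> \<in> ?E" if "\<alpha> \<in> S" for \<alpha>
    proof safe
      fix h assume h: "h \<in> H"
      obtain c where c: "w v* h = c *s w" using w(2)[OF h] by blast
      have fh: "f \<alpha> ** h = h ** f \<alpha> + smul (\<alpha> h) (f \<alpha>)"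
        using S(2)[OF that] h by (simp add: root_space_def brk_eq_iff)
      have "(w v* f \<alpha>) v* h = (w v* h) v* f \<alpha> + \<alpha> h *s (w v* f \<alpha>)"
        by (simp only: vector_matrix_mul_assoc fh vector_matrix_mult_add_rdistrib vector_matrix_mult_smul)
      also have "\<dots> = (c + \<alpha> h) *s (w v* f \<alpha>)"
        by (simp add: c vec.scale_left_distrib scalar_vector_matrix_assoc)
      finally have "(w v* f \<alpha>) v* h = (c + \<alpha> h) *s (w v* f \<alpha>)" .
      then show "\<exists>c. (w v* f \<alpha>) v* h = c *s (w v* f \<alpha>)" by blast
    qed
    moreover have "w \<in> ?E" using w(2) by blast
    ultimately show ?thesis
      unfolding y by (auto intro!: vec.span_add vec.span_scale vec.span_sum intro: vec.span_base)
  qed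
  then show ?thesis by auto
qed

lemma brk_diag3:
  fixes x d :: "'a::field m3"
  assumes "x \<in> diag3" "d \<in> diag3" shows "brk x d = 0"
  using assms by (auto simp: diag3_def brk_def mat_entries algebra_simps)

text \<open>A basis of common row eigenvectors forms the rows of \<open>P\<close>, which puts the
  conjugate of \<open>H\<close> inside \<open>diag3\<close>. Conversely, a diagonal matrix carried
  back commutes with \<open>H\<close>, so it lies in the normalizer of \<open>H\<close>, which is
  \<open>H\<close>.\<close>

lemma classical_cartan_diagonalizable:
  assumes H: "classical_cartan (H :: 'a::field m3 set)"
    and two: "(2::'a) \<noteq> 0" and three: "(3::'a) \<noteq> 0"
  obtains P Q where "P ** Q = mat 1" "Q ** P = mat 1" "conj3 P Q ` H = diag3"
proof -
  let ?E = "{y. \<forall>h\<in>H. \<exists>c. y v* h = c *s y}"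
  obtain B where B: "B \<subseteq> ?E" "vec.independent B" "?E \<subseteq> vec.span B"
    by (rule vec.maximal_independent_subset[of ?E])
  have sB: "vec.span B = UNIV"
    using vec.span_mono[OF B(3)] row_eigenvectors_span[OF H two three] by (simp add: vec.span_span top.extremum_unique)
  have "finite B" using B(2) by (rule vec.finiteI_independent)
  moreover have "card B = 3"
    using vec.dim_eq_card[of B UNIV] sB B(2) by (simp add: card_cart_basis)
  ultimately obtain g where g: "bij_betw g (UNIV :: 3 set) B"
    using finite_same_card_bij[of "UNIV :: 3 set" B] by auto
  define P where "P = (\<chi> i. g i)"
  have "rows P = B"
    using g by (auto simp: rows_def row_def P_def bij_betw_def)
  then obtain Q where QP: "Q ** P = mat 1"
    using sB matrix_left_invertible_span_rows_gen[of P] by auto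
  then have PQ: "P ** Q = mat 1" by (simp add: matrix_left_right_inverse)
  note sub = classical_cartanD(1)[OF H] and norm = classical_cartanD(2)[OF H]
  have HD: "conj3 P Q h \<in> diag3" if h: "h \<in> H" for h
  proof -
    have "g i \<in> ?E" for i using B(1) g by (auto simp: bij_betw_def)
    then have "\<forall>i. \<exists>c. g i v* h = c *s g i" using h by blast
    then obtain c where c: "\<And>i. g i v* h = c i *s g i" by metis
    have "(P ** h) $ i $ j = c i * P $ i $ j" for i j
      using c[of i] by (simp add: vec_eq_iff P_def matrix_matrix_mult_def vector_matrix_mult_def mult.commute)
    then have "conj3 P Q h $ i $ j = c i * (P ** Q) $ i $ j" for i j
      by (simp add: conj3_def matrix_mult_nth3 algebra_simps)
    moreover have "conj3 P Q h \<in> sl3"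
      using QP sub h by (auto simp: subalgebra_def)
    ultimately show ?thesis by (simp add: diag3_def PQ mat_def)
  qed
  have "d \<in> conj3 P Q ` H" if d: "d \<in> diag3" for d
  proof -
    have "conj3 Q P d \<in> normalizer H"
      unfolding normalizer_def
    proof (safe)
      show "conj3 Q P d \<in> sl3" using d PQ by (simp add: diag3_def)
      fix h assume h: "h \<in> H"
      have "brk (conj3 Q P d) h = conj3 Q P (brk d (conj3 P Q h))"
        by (simp add: conj3_brk[OF PQ] conj3_inverse[OF QP])
      also have "\<dots> = 0" using brk_diag3[OF d HD[OF h]] by simp
      finally show "brk (conj3 Q P d) h \<in> H"
        using sub by (simp add: subalgebra_def lsubspace_def)
    qed
    then have "conj3 Q P d \<in> H" using norm by simp
    moreover have "d = conj3 P Q (conj3 Q P d)" by (simp add: conj3_inverse[OF PQ])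
    ultimately show ?thesis by blast
  qed
  then have "conj3 P Q ` H = diag3" using HD by blast
  then show ?thesis using that PQ QP by blast
qed

subsection \<open>Conjugates of the diagonal subalgebra\<close>

text \<open>For condition (b): the brackets of two opposite root spaces already form a line, so
  taking the span adds nothing.\<close>

lemma lspan_line: "lspan {smul c v | c. True} = {smul c v | c. True}"
proof -
  have "\<exists>d. (\<Sum>t\<in>T. smul (c t) t) = smul d v" if "finite T" "T \<subseteq> {smul c v | c. True}" for T c
    using that
  proof (induction T)
    case empty
    then show ?case by (auto intro: exI[of _ 0])
  next
    case (insert t T)
    then obtain d e where "(\<Sum>t\<in>T. smul (c t) t) = smul d v" "t = smul e v" by auto
    with insert(1,2) have "(\<Sum>t\<in>insert t T. smul (c t) t) = smul (c t * e + d) v"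
      by (simp add: smul_smul smul_add_left)
    then show ?case by blast
  qed
  moreover have "smul c v \<in> lspan {smul c v | c. True}" for c
    unfolding lspan_def by (rule CollectI, rule exI[of _ "{smul c v}"], rule exI[of _ "\<lambda>_. 1"]) auto
  ultimately show ?thesis
    unfolding lspan_def by blast
qed

text \<open>Positions of entries are the weights of the diagonal subalgebra; the sign comes from
  bracketing with \<open>d\<close> on the right.\<close>

lemma brk_diag3_nth:
  fixes y d :: "'a::field m3"
  assumes "d \<in> diag3"
  shows "brk y d $ i $ j = (d $ j $ j - d $ i $ i) * y $ i $ j"
proof -
  have d: "d $ 0 $ 1 = 0" "d $ 1 $ 0 = 0" "d $ 0 $ 2 = 0" "d $ 2 $ 0 = 0" "d $ 1 $ 2 = 0" "d $ 2 $ 1 = 0"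
    using assms by (simp_all add: diag3_def)
  have "\<forall>i j. brk y d $ i $ j = (d $ j $ j - d $ i $ i) * y $ i $ j"
    unfolding forall_index3 by (simp add: brk_def matrix_mult_nth3 d algebra_simps)
  then show ?thesis by simp
qed

text \<open>Three times a fundamental coweight: every root takes a value in \<open>{0, 3, -3}\<close> on it, so it detects
that four consecutive terms of a root string in a nonzero direction cannot all be roots.\<close>
definition coweight :: "3 \<Rightarrow> 'a::field m3" where
  "coweight m = (\<chi> i j. if i = j then (if i = m then 2 else - 1) else 0)"

lemma coweight_nth: "coweight m $ i $ j = (if i = j then (if i = m then 2 else - 1) else 0)"
  by (simp add: coweight_def)

lemma coweight_mem_diag3: "coweight m \<in> diag3"
proof -
  have "\<forall>m. (coweight m :: 'a m3) \<in> diag3"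
    unfolding forall_index3 by (auto simp: diag3_def mem_sl3 coweight_nth)
  then show ?thesis by simp
qed

lemma diag3_linear:
  "0 \<in> diag3" "x \<in> diag3 \<Longrightarrow> y \<in> diag3 \<Longrightarrow> x + y \<in> diag3" "x \<in> diag3 \<Longrightarrow> smul c x \<in> diag3"
  by (auto simp: diag3_def zero_mem_sl3) (auto simp: sl3_def trace_add trace_smul)

lemma diag3_sl3: "d \<in> diag3 \<Longrightarrow> d \<in> sl3"
  by (simp add: diag3_def)

definition matrix_unit :: "3 \<Rightarrow> 3 \<Rightarrow> 'a::field m3" where
  "matrix_unit i j = (\<chi> k l. if k = i \<and> l = j then 1 else 0)"

lemma matrix_unit_nth: "matrix_unit i j $ k $ l = (if k = i \<and> l = j then 1 else 0)"
  by (simp add: matrix_unit_def)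

text \<open>Treats all conjugates of \<open>diag3\<close> at once. It is used with
  \<open>P = mat 1\<close> for \<open>diag3\<close> itself and with an eigenvector matrix for the
  cyclic components.\<close>

locale split_torus =
  fixes P Q :: "'a::field m3"
  assumes PQ: "P ** Q = mat 1" and QP: "Q ** P = mat 1"
    and two: "(2::'a) \<noteq> 0" and three: "(3::'a) \<noteq> 0"
begin

abbreviation "\<phi> \<equiv> conj3 P Q"
abbreviation "\<psi> \<equiv> conj3 Q P"

definition torus :: "'a m3 set" where
  "torus = {h. \<phi> h \<in> diag3}"

text \<open>The value 0 outside \<open>torus\<close> follows the convention of
  \<open>lin_functional\<close>, so that equal roots are equal functions. For \<open>i = j\<close>
  this is the zero root.\<close>

definition root_of :: "3 \<Rightarrow> 3 \<Rightarrow> 'a m3 \<Rightarrow> 'a" where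
  "root_of i j h = (if h \<in> torus then \<phi> h $ j $ j - \<phi> h $ i $ i else 0)"

lemma \<phi>_\<psi> [simp]: "\<phi> (\<psi> x) = x" and \<psi>_\<phi> [simp]: "\<psi> (\<phi> x) = x"
  by (simp_all add: conj3_inverse PQ QP)

lemma \<phi>_brk: "\<phi> (brk x y) = brk (\<phi> x) (\<phi> y)"
  by (simp add: conj3_brk QP)

lemma \<phi>_mem_sl3 [simp]: "\<phi> x \<in> sl3 \<longleftrightarrow> x \<in> sl3" and \<psi>_mem_sl3 [simp]: "\<psi> x \<in> sl3 \<longleftrightarrow> x \<in> sl3"
  by (simp_all add: PQ QP)

lemma \<phi>_eq_iff: "\<phi> x = \<phi> y \<longleftrightarrow> x = y"
  by (metis \<psi>_\<phi>)

lemma \<phi>_eq_zero_iff [simp]: "\<phi> x = 0 \<longleftrightarrow> x = 0"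
  using \<phi>_eq_iff[of x 0] by simp

lemma \<psi>_mem_torus [simp]: "\<psi> d \<in> torus \<longleftrightarrow> d \<in> diag3"
  by (simp add: torus_def)

lemma torus_sl3: "h \<in> torus \<Longrightarrow> h \<in> sl3"
  unfolding torus_def using diag3_sl3 by fastforce

lemma root_\<psi>: "d \<in> diag3 \<Longrightarrow> root_of i j (\<psi> d) = d $ j $ j - d $ i $ i"
  by (simp add: root_of_def)

text \<open>The bracket with \<open>h\<close> scales each entry of \<open>\<phi> x\<close> by the
  root of its position, so an entry can be nonzero only where that root agrees with
  \<open>\<alpha>\<close> on \<open>torus\<close>.\<close>

lemma mem_root_space_iff:
  "x \<in> root_space torus \<alpha> \<longleftrightarrow>
     x \<in> sl3 \<and> (\<forall>h\<in>torus. \<forall>i j. root_of i j h * \<phi> x $ i $ j = \<alpha> h * \<phi> x $ i $ j)"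
proof -
  have "brk x h = smul (\<alpha> h) x \<longleftrightarrow> (\<forall>i j. root_of i j h * \<phi> x $ i $ j = \<alpha> h * \<phi> x $ i $ j)"
    if "h \<in> torus" for h
  proof -
    have "brk x h = smul (\<alpha> h) x \<longleftrightarrow> brk (\<phi> x) (\<phi> h) = smul (\<alpha> h) (\<phi> x)"
      by (simp add: \<phi>_eq_iff flip: \<phi>_brk conj3_smul)
    then show ?thesis
      using that by (simp add: vec_eq_iff brk_diag3_nth torus_def root_of_def)
  qed
  then show ?thesis by (auto simp: root_space_def)
qed

lemma torus_linear:
  "0 \<in> torus" "x \<in> torus \<Longrightarrow> y \<in> torus \<Longrightarrow> x + y \<in> torus" "x \<in> torus \<Longrightarrow> smul c x \<in> torus"
  by (simp_all add: torus_def diag3_linear conj3_add conj3_smul)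

lemma brk_torus: "x \<in> torus \<Longrightarrow> y \<in> torus \<Longrightarrow> brk x y = 0"
  using brk_diag3[of "\<phi> x" "\<phi> y"] \<phi>_brk[of x y] by (simp add: torus_def)

lemma lin_functional_root: "lin_functional torus (root_of i j)"
  by (simp add: lin_functional_def root_of_def torus_linear conj3_add conj3_smul algebra_simps)

lemma root_diag: "root_of i i = (\<lambda>_. 0)"
  by (simp add: root_of_def fun_eq_iff)

lemma root_eqI:
  assumes "lin_functional torus \<alpha>" "x \<in> root_space torus \<alpha>" "\<phi> x $ i $ j \<noteq> 0"
  shows "\<alpha> = root_of i j"
proof
  fix h show "\<alpha> h = root_of i j h"
  proof (cases "h \<in> torus")
    case True
    then have "root_of i j h * \<phi> x $ i $ j = \<alpha> h * \<phi> x $ i $ j"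
      using assms(2) by (simp add: mem_root_space_iff)
    then show ?thesis using assms(3) by simp
  next
    case False
    then show ?thesis using assms(1) by (simp add: lin_functional_def root_of_def)
  qed
qed

lemma nonzero_entry: "x \<noteq> 0 \<Longrightarrow> \<exists>i j. \<phi> x $ i $ j \<noteq> 0"
  using \<phi>_eq_zero_iff[of x] by (metis vec_eq_iff zero_index)

lemma is_root_cases:
  assumes "is_root torus \<alpha>"
  obtains i j where "\<alpha> = root_of i j"
proof -
  have "0 \<in> root_space torus \<alpha>" by (simp add: mem_root_space_iff zero_mem_sl3)
  then obtain x where "x \<in> root_space torus \<alpha>" "x \<noteq> 0"
    using assms by (auto simp: is_root_def)
  then show ?thesis using nonzero_entry root_eqI assms that by (metis is_root_def)
qed

text \<open>Coweights separate the roots: on \<open>coweight m\<close> the root of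
  \<open>(i, j)\<close> is 3 if \<open>j = m\<close>, -3 if \<open>i = m\<close> and 0 otherwise.
  These values are distinct because 3 and 6 are nonzero.\<close>

lemma root_inject:
  assumes "i \<noteq> j" "root_of i j = root_of k l"
  shows "k = i \<and> l = j"
proof -
  have "(coweight m :: 'a m3) $ j $ j - coweight m $ i $ i = coweight m $ l $ l - coweight m $ k $ k" for m
    using fun_cong[OF assms(2), of "\<psi> (coweight m)"] by (simp add: root_\<psi> coweight_mem_diag3)
  moreover define t :: 'a where "t = 3"
  have "(coweight m :: 'a m3) $ p $ p = (if p = m then t else 0) - 1" for m p
    by (simp add: coweight_nth t_def)
  ultimately have d: "(if j = m then t else 0) - (if i = m then t else 0) =
      (if l = m then t else 0) - (if k = m then t else 0)" for m
    by (simp only: diff_diff_eq2 diff_add_cancel add_diff_eq)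
  have t: "t \<noteq> 0" "t + t \<noteq> 0"
    using two three mult_eq_0_iff[of "2::'a" 3] by (simp_all add: t_def)
  have "t \<noteq> - t"
    using t(2) by (metis add.right_inverse)
  then have "k = i"
    using d[of i] assms(1) t(1) by (simp split: if_splits)
  moreover from this have "l = j"
    using d[of j] assms(1) t(1) by (simp split: if_splits)
  ultimately show ?thesis by simp
qed

text \<open>No other position has the same root, so a root vector is supported on the single entry
  \<open>(i, j)\<close>.\<close>

lemma mem_root_space_root:
  assumes "i \<noteq> j"
  shows "x \<in> root_space torus (root_of i j) \<longleftrightarrow> (\<exists>c. x = \<psi> (smul c (matrix_unit i j)))"
proof
  assume x: "x \<in> root_space torus (root_of i j)"
  have "\<phi> x $ k $ l = 0" if "\<not> (k = i \<and> l = j)" for k l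
    using root_eqI[OF lin_functional_root x, of k l] root_inject[OF assms, of k l] that by blast
  then have "\<phi> x = smul (\<phi> x $ i $ j) (matrix_unit i j)"
    by (auto simp: vec_eq_iff matrix_unit_nth)
  then show "\<exists>c. x = \<psi> (smul c (matrix_unit i j))" by (metis \<psi>_\<phi>)
next
  assume "\<exists>c. x = \<psi> (smul c (matrix_unit i j))"
  then obtain c where x: "x = \<psi> (smul c (matrix_unit i j))" by blast
  have "trace (matrix_unit i j :: 'a m3) = 0"
    unfolding trace_def using assms by (intro sum.neutral) (auto simp: matrix_unit_nth)
  then have "smul c (matrix_unit i j) \<in> sl3"
    by (simp add: sl3_def trace_smul)
  then show "x \<in> root_space torus (root_of i j)"
    by (simp add: x mem_root_space_iff matrix_unit_nth)
qed

lemma matrix_unit_nonzero: "smul c (matrix_unit i j) = 0 \<longleftrightarrow> c = (0::'a)"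
  by (auto simp: vec_eq_iff matrix_unit_nth)

lemma is_root_root: "is_root torus (root_of i j)"
proof -
  have "\<exists>x. x \<in> root_space torus (root_of i j) \<and> x \<noteq> 0"
  proof (cases "i = j")
    case True
    \<comment> \<open>The root is zero here, and any nonzero element of the torus is a root vector
      for it.\<close>
    have "\<psi> (coweight 0) \<in> root_space torus (root_of i j)"
      unfolding mem_root_space_iff
      by (auto simp: True root_diag coweight_nth root_of_def diag3_sl3 coweight_mem_diag3)
    moreover have "\<psi> (coweight 0) \<noteq> 0"
    proof
      assume "\<psi> (coweight 0) = 0"
      then have "\<phi> (\<psi> (coweight 0)) $ 0 $ 0 = 0" by simp
      then show False using two by (simp add: coweight_nth)
    qed
    ultimately show ?thesis by blast
  next
    case False
    have "\<psi> (smul 1 (matrix_unit i j)) \<in> root_space torus (root_of i j)"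
      using mem_root_space_root[OF False] by blast
    moreover have "\<psi> (smul 1 (matrix_unit i j)) \<noteq> 0"
      by (metis \<phi>_\<psi> \<phi>_eq_zero_iff matrix_unit_nonzero one_neq_zero)
    ultimately show ?thesis by blast
  qed
  then show ?thesis by (auto simp: is_root_def lin_functional_root)
qed

lemma cartan_torus: "cartan torus"
proof -
  have "subalgebra torus"
    by (auto simp: subalgebra_def lsubspace_def torus_linear brk_torus torus_sl3)
  moreover have "nilpotent_alg torus"
    unfolding nilpotent_alg_def by (rule exI[of _ 1]) (auto simp: length_Suc_conv brk_torus)
  moreover have "x \<in> torus" if x: "x \<in> sl3" "\<And>h. h \<in> torus \<Longrightarrow> brk x h \<in> torus" for x
  proof -
    \<comment> \<open>Bracketing with \<open>coweight i\<close> multiplies entry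
      \<open>(i, j)\<close> by -3, and the result must be diagonal.\<close>
    have "\<phi> x $ i $ j = 0" if "i \<noteq> j" for i j
    proof -
      have "brk (\<phi> x) (coweight i) \<in> diag3"
        using x(2)[of "\<psi> (coweight i)"] by (simp add: coweight_mem_diag3 torus_def \<phi>_brk)
      then have "brk (\<phi> x) (coweight i) $ i $ j = 0"
        using that by (simp add: diag3_def)
      then show ?thesis
        using that three by (simp add: brk_diag3_nth[OF coweight_mem_diag3] coweight_nth)
    qed
    then show ?thesis using x(1) by (simp add: torus_def diag3_def)
  qed
  then have "normalizer torus = torus"
    by (auto simp: normalizer_def torus_sl3 brk_torus torus_linear)
  ultimately show ?thesis by (simp add: cartan_def)
qed

lemma root_space_sum:
  assumes x: "x \<in> sl3"
  shows "\<exists>S f. finite S \<and> (\<forall>\<alpha>\<in>S. is_root torus \<alpha> \<and> f \<alpha> \<in> root_space torus \<alpha>) \<and> x = (\<Sum>\<alpha>\<in>S. f \<alpha>)"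
proof -
  define S where "S = (\<lambda>(i, j). root_of i j) ` UNIV"
  \<comment> \<open>Entries are grouped by root and not by position, since the three diagonal
    positions share the zero root.\<close>
  define g where "g \<alpha> = (\<chi> i j. if root_of i j = \<alpha> then \<phi> x $ i $ j else 0)" for \<alpha>
  have S: "finite S" by (simp add: S_def)
  have mem: "root_of i j \<in> S" for i j by (auto simp: S_def)
  have "\<forall>\<alpha>\<in>S. is_root torus \<alpha>" by (auto simp: S_def is_root_root)
  moreover have "\<psi> (g \<alpha>) \<in> root_space torus \<alpha>" for \<alpha>
  proof -
    have "\<phi> x \<in> sl3" using x by simp
    then have "g \<alpha> \<in> sl3" by (auto simp: g_def mem_sl3 root_diag)
    then show ?thesis by (auto simp: mem_root_space_iff g_def)
  qed
  moreover have "x = (\<Sum>\<alpha>\<in>S. \<psi> (g \<alpha>))"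
  proof -
    have "(\<Sum>\<alpha>\<in>S. g \<alpha>) $ i $ j = \<phi> x $ i $ j" for i j
      using S mem[of i j] by (simp add: sum_component g_def)
    then have "(\<Sum>\<alpha>\<in>S. g \<alpha>) = \<phi> x" by (simp add: vec_eq_iff)
    then show ?thesis by (simp flip: conj3_sum)
  qed
  ultimately show ?thesis using S
    by (intro exI[of _ S] exI[of _ "\<lambda>\<alpha>. \<psi> (g \<alpha>)"] conjI ballI) simp_all
qed

text \<open>A nonzero entry of a root vector determines its root, so at such an entry of
  \<open>\<phi> (f \<alpha>)\<close> all other summands vanish.\<close>

lemma root_spaces_independent:
  assumes S: "finite S" "\<And>\<alpha>. \<alpha> \<in> S \<Longrightarrow> is_root torus \<alpha>" "\<And>\<alpha>. \<alpha> \<in> S \<Longrightarrow> f \<alpha> \<in> root_space torus \<alpha>"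
    and sum: "(\<Sum>\<alpha>\<in>S. f \<alpha>) = 0" and \<alpha>: "\<alpha> \<in> S"
  shows "f \<alpha> = 0"
proof (rule ccontr)
  assume "f \<alpha> \<noteq> 0"
  then obtain i j where ij: "\<phi> (f \<alpha>) $ i $ j \<noteq> 0" using nonzero_entry by blast
  have root: "\<beta> = root_of i j" if "\<beta> \<in> S" "\<phi> (f \<beta>) $ i $ j \<noteq> 0" for \<beta>
    using root_eqI S that by (metis is_root_def)
  have "0 = (\<Sum>\<beta>\<in>S. \<phi> (f \<beta>) $ i $ j)"
    using arg_cong[OF sum, of "\<lambda>x. \<phi> x $ i $ j"] by (simp add: conj3_sum sum_component)
  also have "\<dots> = (\<Sum>\<beta>\<in>{\<alpha>}. \<phi> (f \<beta>) $ i $ j)"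
    using S(1) \<alpha> root[OF \<alpha> ij] root by (intro sum.mono_neutral_right) auto
  finally show False using ij by simp
qed

lemma brk_matrix_unit:
  assumes "i \<noteq> j"
  shows "brk (smul s (matrix_unit i j)) (smul t (matrix_unit j i)) =
    smul (s * t) (matrix_unit i i - matrix_unit j j :: 'a m3)"
proof -
  have "\<forall>i j. i \<noteq> j \<longrightarrow> brk (smul s (matrix_unit i j)) (smul t (matrix_unit j i)) =
    smul (s * t) (matrix_unit i i - matrix_unit j j :: 'a m3)"
    unfolding forall_index3 by (simp add: vec_eq_iff forall_index3 brk_def matrix_mult_nth3 matrix_unit_nth)
  then show ?thesis using assms by blast
qed

text \<open>Opposite root spaces are spanned by opposite matrix units, whose bracket is the coroot,
  the difference of two diagonal units.\<close>

lemma root_bracket_one_dimensional: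
  assumes "is_root torus \<alpha>" "\<alpha> \<noteq> (\<lambda>_. 0)"
  shows "one_dimensional (lspan {brk x y | x y. x \<in> root_space torus \<alpha> \<and> y \<in> root_space torus (\<lambda>h. - \<alpha> h)})"
proof -
  obtain i j where \<alpha>: "\<alpha> = root_of i j" using is_root_cases[OF assms(1)] .
  have ij: "i \<noteq> j" using assms(2) root_diag \<alpha> by auto
  have neg: "(\<lambda>h. - \<alpha> h) = root_of j i" by (auto simp: \<alpha> root_of_def)
  define v :: "'a m3" where "v = \<psi> (matrix_unit i i - matrix_unit j j)"
  have brk: "brk (\<psi> (smul s (matrix_unit i j))) (\<psi> (smul t (matrix_unit j i))) = smul (s * t) v" for s t
    using brk_matrix_unit[OF ij, of s t] by (simp add: v_def conj3_brk[OF PQ, symmetric] conj3_smul[symmetric])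
  have L: "x \<in> root_space torus \<alpha> \<longleftrightarrow> (\<exists>c. x = \<psi> (smul c (matrix_unit i j)))"
    and R: "x \<in> root_space torus (\<lambda>h. - \<alpha> h) \<longleftrightarrow> (\<exists>c. x = \<psi> (smul c (matrix_unit j i)))" for x
    unfolding neg unfolding \<alpha> using mem_root_space_root ij by simp_all
  have eq: "{brk x y | x y. x \<in> root_space torus \<alpha> \<and> y \<in> root_space torus (\<lambda>h. - \<alpha> h)} = {smul c v | c. True}"
    (is "?A = ?B")
  proof (intro subset_antisym subsetI)
    fix z assume "z \<in> ?A"
    then obtain s t where "z = brk (\<psi> (smul s (matrix_unit i j))) (\<psi> (smul t (matrix_unit j i)))"
      unfolding L R by blast
    then show "z \<in> ?B" unfolding brk by blast
  next
    fix z assume "z \<in> ?B"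
    then obtain c where "z = smul (c * 1) v" by auto
    then have "z = brk (\<psi> (smul c (matrix_unit i j))) (\<psi> (smul 1 (matrix_unit j i)))"
      unfolding brk .
    then show "z \<in> ?A" unfolding L R by blast
  qed
  have "v \<noteq> 0"
  proof
    assume "v = 0"
    then have "\<phi> v $ i $ i = 0" by simp
    then show False using ij by (simp add: v_def matrix_unit_nth)
  qed
  then show ?thesis
    unfolding one_dimensional_def eq lspan_line by blast
qed

lemma root_coweight: "root_of i j (\<psi> (coweight m)) \<in> {0, 3, - 3}"
  by (auto simp: root_\<psi> coweight_mem_diag3) (auto simp: coweight_nth)

text \<open>Evaluate on \<open>coweight i\<close>, where \<open>\<beta>\<close> is -3: the string
  descends in steps of 3 from one of 0, 3, -3 and reaches -6, which is no value of a root. The range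
  of \<open>k\<close> fits condition (c) once the characteristic exceeds 3.\<close>

lemma root_string_bound:
  assumes "is_root torus \<alpha>" "is_root torus \<beta>" "\<beta> \<noteq> (\<lambda>_. 0)"
  shows "\<exists>k\<in>{1..3}. \<not> is_root torus (\<lambda>h. \<alpha> h + of_nat k * \<beta> h)"
proof (rule ccontr)
  assume "\<not> ?thesis"
  then have r: "is_root torus (\<lambda>h. \<alpha> h + of_nat k * \<beta> h)" if "k \<in> {1..3}" for k
    using that by blast
  obtain i j where \<beta>: "\<beta> = root_of i j" using is_root_cases[OF assms(2)] .
  have ij: "i \<noteq> j" using assms(3) root_diag \<beta> by auto
  have val: "\<gamma> (\<psi> (coweight i)) \<in> {0, 3, - 3}" if "is_root torus \<gamma>" for \<gamma>
    using is_root_cases[OF that] root_coweight by metis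
  have b: "\<beta> (\<psi> (coweight i)) = - 3"
    using ij by (simp add: \<beta> root_\<psi> coweight_mem_diag3) (simp add: coweight_nth)
  define a where "a = \<alpha> (\<psi> (coweight i))"
  have a: "a \<in> {0, 3, -3}" using val[OF assms(1)] by (simp add: a_def)
  have "a + of_nat k * (- 3) \<in> {0, 3, - 3}" if "k \<in> {1..3}" for k
    using val[OF r[OF that]] by (simp add: a_def b)
  from this[of 1] this[of 2] this[of 3]
  have k: "a - 3 \<in> {0, 3, - 3}" "a - 6 \<in> {0, 3, - 3}" "a - 9 \<in> {0, 3, - 3}" by simp_all
  have n: "(6::'a) \<noteq> 0" "(9::'a) \<noteq> 0"
    using two three mult_eq_0_iff[of "2::'a" 3] mult_eq_0_iff[of "3::'a" 3] by simp_all
  \<comment> \<open>The differences of -6 from 0, 3, -3 are 6, 9, 3 up to sign, all nonzero.\<close>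
  have m6: "(- 6::'a) \<notin> {0, 3, - 3}"
  proof
    assume "(- 6::'a) \<in> {0, 3, - 3}"
    then consider "(6::'a) = 0" | "- 6 = (3::'a)" | "- 6 = (- 3::'a)" by auto
    then show False
    proof cases
      case 2
      have "(9::'a) = 3 - (- 6)" by simp
      also have "\<dots> = 0" unfolding 2 by simp
      finally show False using n by simp
    next
      case 3
      have "(3::'a) = - 3 - (- 6)" by simp
      also have "\<dots> = 0" unfolding 3 by simp
      finally show False using three by simp
    qed (use n in simp)
  qed
  \<comment> \<open>The value -6 is attained at \<open>k = 2\<close>, \<open>k = 3\<close>,
    \<open>k = 1\<close> respectively.\<close>
  from a consider "a = 0" | "a = 3" | "a = - 3" by auto
  then show False using k m6 by cases auto
qed

lemma classical_cartan_torus: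
  assumes "CHAR('a) > 3"
  shows "classical_cartan torus"
proof -
  have "\<not> (\<forall>k. 1 \<le> k \<and> k \<le> CHAR('a) - 1 \<longrightarrow> is_root torus (\<lambda>h. \<alpha> h + of_nat k * \<beta> h))"
    if roots: "is_root torus \<alpha> \<and> is_root torus \<beta> \<and> \<beta> \<noteq> (\<lambda>_. 0)" for \<alpha> \<beta>
  proof -
    obtain k where "k \<in> {1..3}" "\<not> is_root torus (\<lambda>h. \<alpha> h + of_nat k * \<beta> h)"
      using root_string_bound roots by blast
    moreover from this have "1 \<le> k \<and> k \<le> CHAR('a) - 1" using assms by auto
    ultimately show ?thesis by blast
  qed
  moreover have "abelian torus" by (simp add: abelian_def brk_torus)
  moreover have "\<forall>S f. finite S \<and> (\<forall>\<alpha>\<in>S. is_root torus \<alpha> \<and> f \<alpha> \<in> root_space torus \<alpha>)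
      \<and> (\<Sum>\<alpha>\<in>S. f \<alpha>) = 0 \<longrightarrow> (\<forall>\<alpha>\<in>S. f \<alpha> = 0)"
    by (intro allI impI ballI; elim conjE) (rule root_spaces_independent; simp)
  moreover have "\<forall>\<alpha>. is_root torus \<alpha> \<and> \<alpha> \<noteq> (\<lambda>_. 0) \<longrightarrow>
      one_dimensional (lspan {brk x y | x y. x \<in> root_space torus \<alpha> \<and> y \<in> root_space torus (\<lambda>h. - \<alpha> h)})"
    using root_bracket_one_dimensional by blast
  ultimately show ?thesis
    unfolding classical_cartan_def using cartan_torus root_space_sum
    by (intro conjI allI ballI) simp_all
qed

end

subsection \<open>Cyclic generators and the standard decomposition\<close>

text \<open>Meant for \<open>A\<close> with cube 1, where \<open>A ** A\<close> is the inverse of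
  \<open>A\<close>; every classical Cartan subalgebra will be brought to this form.\<close>

definition span2 :: "'a::field m3 \<Rightarrow> 'a m3 set" where
  "span2 A = {smul a A + smul b (A ** A) | a b. True}"

text \<open>A weighted cyclic permutation matrix; its cube is the scalar matrix
  \<open>a * d * e\<close>.\<close>

definition cyc_shift :: "'a::field \<Rightarrow> 'a \<Rightarrow> 'a \<Rightarrow> 'a m3" where
  "cyc_shift a d e = mat3 0 a 0 0 0 d e 0 0"

definition cyc_plane :: "'a::field \<Rightarrow> 'a \<Rightarrow> 'a m3 set" where
  "cyc_plane l m = {smul a (mat3 0 1 0 0 0 l m 0 0) + smul b (mat3 0 0 1 m 0 0 0 l 0) | a b. True}"

lemma mat3_nth:
  "mat3 a b c d e f g h i $ 0 $ 0 = a" "mat3 a b c d e f g h i $ 0 $ 1 = b" "mat3 a b c d e f g h i $ 0 $ 2 = c"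
  "mat3 a b c d e f g h i $ 1 $ 0 = d" "mat3 a b c d e f g h i $ 1 $ 1 = e" "mat3 a b c d e f g h i $ 1 $ 2 = f"
  "mat3 a b c d e f g h i $ 2 $ 0 = g" "mat3 a b c d e f g h i $ 2 $ 1 = h" "mat3 a b c d e f g h i $ 2 $ 2 = i"
  by (simp_all add: mat3_def)

lemma m3_eq_iff:
  "A = B \<longleftrightarrow> A $ 0 $ 0 = B $ 0 $ 0 \<and> A $ 0 $ 1 = B $ 0 $ 1 \<and> A $ 0 $ 2 = B $ 0 $ 2 \<and>
     A $ 1 $ 0 = B $ 1 $ 0 \<and> A $ 1 $ 1 = B $ 1 $ 1 \<and> A $ 1 $ 2 = B $ 1 $ 2 \<and>
     A $ 2 $ 0 = B $ 2 $ 0 \<and> A $ 2 $ 1 = B $ 2 $ 1 \<and> A $ 2 $ 2 = B $ 2 $ 2"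
  for A B :: "'a m3"
  by (auto simp: vec_eq_iff forall_index3)

lemma mat1_nth3:
  "(mat 1 :: 'a::field m3) = mat3 1 0 0 0 1 0 0 0 1"
  by (simp add: m3_eq_iff mat3_nth mat_def)

lemma span2_image: "Q ** P = mat 1 \<Longrightarrow> conj3 P Q ` span2 A = span2 (conj3 P Q A)"
  unfolding span2_def
  by (force simp: conj3_add conj3_smul conj3_mult[symmetric])

lemma span2_rescale:
  assumes "c \<noteq> 0" "d \<noteq> 0"
  shows "{smul a (smul c A) + smul b (smul d B) | a b. True} = {smul a A + smul b B | a b. True}" (is "?L = ?R")
proof (intro subset_antisym subsetI)
  fix x assume "x \<in> ?R"
  then obtain a b where "x = smul a A + smul b B" by blast
  then have "x = smul (a / c) (smul c A) + smul (b / d) (smul d B)"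
    using assms by (simp add: smul_smul)
  then show "x \<in> ?L" by blast
qed (auto simp: smul_smul)

lemma generators_mem_span2: "A \<in> span2 A" "A ** A \<in> span2 A"
proof -
  have "A = smul 1 A + smul 0 (A ** A)" "A ** A = smul 0 A + smul 1 (A ** A)" by simp_all
  then show "A \<in> span2 A" "A ** A \<in> span2 A" unfolding span2_def by blast+
qed

text \<open>Since \<open>A^4 = A\<close>, squaring exchanges the two generators.\<close>

lemma span2_square:
  assumes "A ** A ** A = mat 1"
  shows "span2 (A ** A) = span2 A"
proof -
  have "(A ** A) ** (A ** A) = A"
    using assms by (metis matrix_mul_assoc matrix_mul_lid)
  then show ?thesis
    unfolding span2_def by (auto simp: add.commute)
qed

lemma diag3_iff:
  "A \<in> diag3 \<longleftrightarrow> A $ 0 $ 1 = 0 \<and> A $ 0 $ 2 = 0 \<and> A $ 1 $ 0 = 0 \<and> A $ 1 $ 2 = 0 \<and> A $ 2 $ 0 = 0 \<and> A $ 2 $ 1 = 0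
     \<and> A $ 0 $ 0 + A $ 1 $ 1 + A $ 2 $ 2 = 0"
  by (auto simp: diag3_def mem_sl3 forall_index3)

locale cube_root =
  fixes u :: "'a::field"
  assumes u3: "u ^ 3 = 1" and u1: "u \<noteq> 1" and two: "(2::'a) \<noteq> 0" and three: "(3::'a) \<noteq> 0"
begin

lemma u_sum: "1 + u + u^2 = 0"
proof -
  have "(u - 1) * (1 + u + u^2) = 0"
    using u3 by (simp add: algebra_simps power2_eq_square power3_eq_cube)
  then show ?thesis using u1 by simp
qed

lemma u3': "u * u * u = 1"
  using u3 by (simp add: power3_eq_cube)

lemma u2: "u * u = - 1 - u"
  using u_sum by (metis add.commute add_diff_cancel_left' diff_0 diff_diff_eq2 diff_minus_eq_add eq_neg_iff_add_eq_0 minus_diff_eq power2_eq_square uminus_add_conv_diff)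

lemma diag3_eq_span2: "diag3 = span2 (mat3 1 0 0 0 u 0 0 0 (u^2))" (is "_ = span2 ?L")
proof (intro subset_antisym subsetI)
  have LL: "?L ** ?L = mat3 1 0 0 0 (u^2) 0 0 0 u"
    using u3' by (simp add: m3_eq_iff matrix_mult_nth3 mat3_nth power2_eq_square ac_simps)
  fix x :: "'a m3"
  {
    assume x: "x \<in> diag3"
    define p q where "p = x $ 0 $ 0" and "q = x $ 1 $ 1"
    have r: "x $ 2 $ 2 = - p - q" using x by (simp add: diag3_iff p_def q_def eq_neg_iff_add_eq_0 algebra_simps)
    \<comment> \<open>Inverse discrete Fourier transform of the diagonal
      \<open>(p, q, - p - q)\<close>; the coefficient of the identity matrix is zero because the
      trace is.\<close>
    define a where "a = (p + u^2 * q + u * (- p - q)) / 3"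
    define b where "b = (p + u * q + u^2 * (- p - q)) / 3"
    have ab: "3 * a = p + u^2 * q + u * (- p - q)" "3 * b = p + u * q + u^2 * (- p - q)"
      using three by (simp_all add: a_def b_def)
    have "3 * a + 3 * b = 3 * p" "3 * a * u + 3 * b * u^2 = 3 * q" "3 * a * u^2 + 3 * b * u = 3 * (- p - q)"
      unfolding ab using u_sum by algebra+
    then have "3 * (a + b) = 3 * p" "3 * (a * u + b * u^2) = 3 * q" "3 * (a * u^2 + b * u) = 3 * (- p - q)"
      by (simp_all only: distrib_left mult.assoc)
    then have "a + b = p" "a * u + b * u^2 = q" "a * u^2 + b * u = - p - q"
      using three by (metis mult_cancel_left)+
    then have "x = smul a ?L + smul b (?L ** ?L)"
      using x r unfolding LL by (simp add: m3_eq_iff mat3_nth diag3_iff p_def q_def)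
    then show "x \<in> span2 ?L" unfolding span2_def by blast
  next
    assume "x \<in> span2 ?L"
    then obtain a b where x: "x = smul a ?L + smul b (?L ** ?L)" unfolding span2_def by blast
    have "a + b + (a * u + b * u^2) + (a * u^2 + b * u) = 0" using u_sum by algebra
    then show "x \<in> diag3" unfolding x LL by (simp add: diag3_iff mat3_nth)
  }
qed

lemma L_cubed: "mat3 1 0 0 0 u 0 0 0 (u^2) ** mat3 1 0 0 0 u 0 0 0 (u^2) ** mat3 1 0 0 0 u 0 0 0 (u^2) = mat 1"
proof -
  have "u^2 * u^2 * u^2 = 1" using u3 by algebra
  then show ?thesis
    using u3' by (simp add: mat1_nth3 m3_eq_iff matrix_mult_nth3 mat3_nth)
qed

text \<open>The hypotheses say that \<open>l\<close> is a cube root of unity with inverse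
  \<open>m\<close>. Then the second generator is \<open>m\<close> times the square of the
  first.\<close>

lemma cyc_plane_eq_span2:
  assumes "l * m = 1" "l * l = m" "m * m = l"
  shows "cyc_plane l m = span2 (cyc_shift 1 l m)"
proof -
  have m: "m \<noteq> 0" using assms(1) by auto
  have "mat3 0 0 1 m 0 0 0 l 0 = smul m (cyc_shift 1 l m ** cyc_shift 1 l m)"
    using assms by (simp add: m3_eq_iff cyc_shift_def mat3_nth matrix_mult_nth3 ac_simps)
  then show ?thesis
    using span2_rescale[of 1 m "cyc_shift 1 l m" "cyc_shift 1 l m ** cyc_shift 1 l m"] m
    by (simp add: cyc_plane_def span2_def cyc_shift_def)
qed

text \<open>Diagonalizing the cyclic generator turns it into the diagonal matrix with entries 1,
  \<open>u\<close>, \<open>u^2\<close>, which with its square spans \<open>diag3\<close>. So the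
  plane is a conjugate of \<open>diag3\<close>.\<close>

lemma classical_cartan_cyc_plane:
  fixes l m :: 'a
  assumes l: "l * m = 1" "l * l = m" "m * m = l" and char: "CHAR('a) > 3"
  shows "classical_cartan (cyc_plane l m)"
proof -
  \<comment> \<open>The rows of \<open>P\<close> are the row eigenvectors \<open>(1, x\<^sup>2, x l)\<close> of \<open>cyc_shift 1 l m\<close>
    for the eigenvalues \<open>x = 1, u, u\<^sup>2\<close>.\<close>
  define P where "P = mat3 1 1 l 1 (u^2) (u * l) 1 u (u^2 * l)"
  \<comment> \<open>The columns are the entrywise inverses of the rows of \<open>P\<close>, divided
    by 3; \<open>Q\<close> inverts \<open>P\<close> by orthogonality of the characters of the cyclic
    group of order 3.\<close>
  define Q where "Q = smul (1 / 3) (mat3 1 1 1 1 u (u^2) m (m * u^2) (m * u))"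
  have PQ: "P ** Q = mat 1"
  proof -
    have "P ** mat3 1 1 1 1 u (u^2) m (m * u^2) (m * u) = smul 3 (mat 1)"
      unfolding P_def m3_eq_iff matrix_mult_nth3 mat1_nth3 smul_nth mat3_nth
      using l(1) u_sum by (intro conjI; algebra)
    then show ?thesis using three by (simp add: Q_def smul_mult_right smul_smul)
  qed
  then have QP: "Q ** P = mat 1" by (simp add: matrix_left_right_inverse)
  interpret split_torus P Q
    by unfold_locales (fact PQ QP two three)+
  have "P ** cyc_shift 1 l m = mat3 1 0 0 0 u 0 0 0 (u^2) ** P"
  proof -
    have "u * (u * u) = 1" "u * (u * (u * x)) = x" for x
      using u3' by (simp_all flip: mult.assoc)
    then show ?thesis
      using l(1) by (simp add: P_def cyc_shift_def m3_eq_iff matrix_mult_nth3 mat3_nth power2_eq_square mult.assoc)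
  qed
  then have \<phi>: "\<phi> (cyc_shift 1 l m) = mat3 1 0 0 0 u 0 0 0 (u^2)"
    by (simp add: conj3_def PQ flip: matrix_mul_assoc)
  have "torus = \<psi> ` diag3"
    by (auto simp: torus_def image_iff) (metis \<psi>_\<phi>)
  also have "\<dots> = span2 (\<psi> (\<phi> (cyc_shift 1 l m)))"
    unfolding \<phi> diag3_eq_span2 by (rule span2_image[OF PQ])
  also have "\<dots> = cyc_plane l m" using cyc_plane_eq_span2[OF l] by simp
  finally show ?thesis using classical_cartan_torus[OF char] by simp
qed

lemma classical_cartan_diag3:
  assumes "CHAR('a) > 3"
  shows "classical_cartan (diag3 :: 'a m3 set)"
proof -
  interpret split_torus "mat 1" "mat 1 :: 'a m3"
    by unfold_locales (simp_all add: two three)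
  have "torus = diag3" by (simp add: torus_def conj3_def)
  then show ?thesis using classical_cartan_torus[OF assms] by simp
qed

section \<open>The standard decomposition is a COD\<close>

lemma J3_eq:
  "J3 u 0 = diag3" "J3 u 1 = cyc_plane 1 1" "J3 u 2 = cyc_plane u (u^2)" "J3 u 3 = cyc_plane (u^2) u"
  by (simp_all add: J3_def diag3_def cyc_plane_def)

lemma killing_diag3_cyc_plane:
  assumes "d \<in> diag3" "x \<in> cyc_plane l m"
  shows "killing d x = 0" "killing x d = 0"
  using assms by (auto simp: killing_def trace_def sum_index3 matrix_mult_nth3 diag3_iff cyc_plane_def mat3_nth)

text \<open>Only products of generators of opposite orientation have a nonzero diagonal, and each
  such product has trace \<open>m + m' + l * l'\<close>. For two different components of
  \<open>J3 u\<close> this is \<open>1 + u + u^2\<close>.\<close>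

lemma killing_cyc_plane:
  assumes "x \<in> cyc_plane l m" "y \<in> cyc_plane l' m'" "m + m' + l * l' = 0"
  shows "killing x y = 0"
proof -
  obtain a b c d where "x = smul a (mat3 0 1 0 0 0 l m 0 0) + smul b (mat3 0 0 1 m 0 0 0 l 0)"
    "y = smul c (mat3 0 1 0 0 0 l' m' 0 0) + smul d (mat3 0 0 1 m' 0 0 0 l' 0)"
    using assms(1,2) unfolding cyc_plane_def by blast
  then have "killing x y = 6 * (a * d * (m + m' + l * l') + b * c * (m + m' + l * l'))"
    by (simp add: killing_def trace_def sum_index3 matrix_mult_nth3 mat3_nth algebra_simps)
  then show ?thesis using assms(3) by simp
qed

text \<open>Inverse Fourier transform on three points. It distributes the entries along one cyclic
  direction over the three cyclic planes.\<close>

lemma fourier3: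
  obtains a b c where "a + b + c = x" "a + u * b + u^2 * c = y" "a + u^2 * b + u * c = z"
proof -
  define a b c where "a = (x + y + z) / 3" and "b = (x + u^2 * y + u * z) / 3" and "c = (x + u * y + u^2 * z) / 3"
  have abc: "3 * a = x + y + z" "3 * b = x + u^2 * y + u * z" "3 * c = x + u * y + u^2 * z"
    using three by (simp_all add: a_def b_def c_def)
  have "3 * a + 3 * b + 3 * c = 3 * x" "3 * a + u * (3 * b) + u^2 * (3 * c) = 3 * y"
    "3 * a + u^2 * (3 * b) + u * (3 * c) = 3 * z"
    unfolding abc using u_sum by algebra+
  then have "3 * (a + b + c) = 3 * x" "3 * (a + u * b + u^2 * c) = 3 * y" "3 * (a + u^2 * b + u * c) = 3 * z"
    by (simp_all only: distrib_left mult.left_commute)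
  then show ?thesis using that three by (metis mult_cancel_left)
qed

lemma fourier3_zero:
  assumes "a + b + c = 0" "a + u * b + u^2 * c = 0" "a + u^2 * b + u * c = 0"
  shows "a = 0" "b = 0" "c = 0"
proof -
  have "3 * a = (a + b + c) + (a + u * b + u^2 * c) + (a + u^2 * b + u * c)"
    "3 * b = (a + b + c) + u^2 * (a + u * b + u^2 * c) + u * (a + u^2 * b + u * c)"
    "3 * c = (a + b + c) + u * (a + u * b + u^2 * c) + u^2 * (a + u^2 * b + u * c)"
    using u_sum by algebra+
  then show "a = 0" "b = 0" "c = 0"
    unfolding assms using three by simp_all
qed

lemma all_le_3: "(\<forall>i\<le>3. p i) \<longleftrightarrow> p 0 \<and> p 1 \<and> p 2 \<and> p (3::nat)"
  by (auto simp: numeral_3_eq_3 numeral_2_eq_2 le_Suc_eq)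

lemma sum_le_3: "(\<Sum>i\<le>3. h i) = h 0 + h 1 + h 2 + h (3::nat)" for h :: "nat \<Rightarrow> 'a m3"
  by (simp add: numeral_3_eq_3 numeral_2_eq_2)

lemma is_COD_J3:
  assumes char: "CHAR('a) > 3"
  shows "is_COD (J3 u)"
  unfolding is_COD_def
proof (intro conjI)
  have u: "u * u^2 = 1" "u * u = u^2" "u^2 * u = 1" "u^2 * u^2 = u"
    using u3' by (simp_all add: power2_eq_square flip: mult.assoc)
  show "\<forall>i\<le>3. classical_cartan (J3 u i)"
    unfolding all_le_3 J3_eq
    using classical_cartan_diag3[OF char] classical_cartan_cyc_plane[OF _ _ _ char] u by simp
  have s: "1 + u^2 + u = 0" "u^2 + 1 + u = 0" "u + 1 + u^2 = 0" "u + u^2 + 1 = 0" "u^2 + u + 1 = 0"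
    using u_sum by (simp_all add: ac_simps)
  show "\<forall>i\<le>3. \<forall>j\<le>3. i \<noteq> j \<longrightarrow> (\<forall>x\<in>J3 u i. \<forall>y\<in>J3 u j. killing x y = 0)"
  proof -
    have k: "killing x y = 0" "killing y x = 0" if "x \<in> cyc_plane l m" "y \<in> cyc_plane l' m'" "m + m' + l * l' = 0" for x y l m l' m'
      using killing_cyc_plane[OF that] killing_cyc_plane[OF that(2,1)] that(3) by (simp_all add: ac_simps)
    have "\<forall>x\<in>cyc_plane 1 1. \<forall>y\<in>cyc_plane u (u^2). killing x y = 0 \<and> killing y x = 0"
      "\<forall>x\<in>cyc_plane 1 1. \<forall>y\<in>cyc_plane (u^2) u. killing x y = 0 \<and> killing y x = 0"
      "\<forall>x\<in>cyc_plane u (u^2). \<forall>y\<in>cyc_plane (u^2) u. killing x y = 0 \<and> killing y x = 0"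
      by (intro ballI conjI; erule (1) k; simp add: u s)+
    then show ?thesis
      unfolding all_le_3 J3_eq using killing_diag3_cyc_plane by simp blast
  qed
  show "\<forall>x\<in>sl3. \<exists>h. (\<forall>i\<le>3. h i \<in> J3 u i) \<and> x = (\<Sum>i\<le>3. h i)"
  proof
    fix x :: "'a m3" assume x: "x \<in> sl3"
    define d where "d = mat3 (x $ 0 $ 0) 0 0 0 (x $ 1 $ 1) 0 0 0 (x $ 2 $ 2)"
    \<comment> \<open>The off-diagonal positions split into two cyclic directions, each listed in
      the order in which a generator has the coefficients 1, \<open>l\<close>,
      \<open>m\<close>.\<close>
    obtain a b c where a: "a + b + c = x $ 0 $ 1" "a + u * b + u^2 * c = x $ 1 $ 2" "a + u^2 * b + u * c = x $ 2 $ 0"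
      by (rule fourier3)
    obtain a' b' c' where b: "a' + b' + c' = x $ 0 $ 2" "a' + u * b' + u^2 * c' = x $ 2 $ 1" "a' + u^2 * b' + u * c' = x $ 1 $ 0"
      by (rule fourier3)
    define g where "g l m s t = smul s (mat3 0 1 0 0 0 l m 0 0) + smul t (mat3 0 0 1 m 0 0 0 l 0)" for l m s t :: 'a
    define h where "h k = (if k = 0 then d else if k = 1 then g 1 1 a a' else if k = 2 then g u (u^2) b b' else g (u^2) u c c')" for k :: nat
    have h: "h 0 = d" "h 1 = g 1 1 a a'" "h 2 = g u (u^2) b b'" "h 3 = g (u^2) u c c'"
      by (simp_all add: h_def)
    have "g l m s t \<in> cyc_plane l m" for l m s t
      unfolding g_def cyc_plane_def by blast
    moreover have "d \<in> diag3" using x by (simp add: diag3_iff d_def mat3_nth mem_sl3)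
    ultimately have "\<forall>i\<le>3. h i \<in> J3 u i"
      unfolding all_le_3 J3_eq h by blast
    moreover have "x = (\<Sum>i\<le>3. h i)"
      unfolding sum_le_3 h using a b
      by (simp add: m3_eq_iff g_def d_def mat3_nth ac_simps)
    ultimately show "\<exists>h. (\<forall>i\<le>3. h i \<in> J3 u i) \<and> x = (\<Sum>i\<le>3. h i)" by blast
  qed
  show "\<forall>h. (\<forall>i\<le>3. h i \<in> J3 u i) \<and> (\<Sum>i\<le>3. h i) = 0 \<longrightarrow> (\<forall>i\<le>3. h i = 0)"
  proof (rule allI, rule impI, elim conjE)
    fix h assume h: "\<forall>i\<le>3. h i \<in> J3 u i" and sum: "(\<Sum>i\<le>(3::nat). h i) = 0"
    have d: "h 0 \<in> diag3" and "h 1 \<in> cyc_plane 1 1" "h 2 \<in> cyc_plane u (u^2)" "h 3 \<in> cyc_plane (u^2) u"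
      using h unfolding all_le_3 J3_eq by blast+
    then obtain a a' b b' c c' where h:
      "h 1 = smul a (mat3 0 1 0 0 0 1 1 0 0) + smul a' (mat3 0 0 1 1 0 0 0 1 0)"
      "h 2 = smul b (mat3 0 1 0 0 0 u (u^2) 0 0) + smul b' (mat3 0 0 1 (u^2) 0 0 0 u 0)"
      "h 3 = smul c (mat3 0 1 0 0 0 (u^2) u 0 0) + smul c' (mat3 0 0 1 u 0 0 0 (u^2) 0)"
      unfolding cyc_plane_def by blast
    have eqs: "a + b + c = 0" "a + u * b + u^2 * c = 0" "a + u^2 * b + u * c = 0"
      "a' + b' + c' = 0" "a' + u * b' + u^2 * c' = 0" "a' + u^2 * b' + u * c' = 0"
      using sum d unfolding sum_le_3 h diag3_iff by (simp_all add: m3_eq_iff mat3_nth ac_simps)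
    note fourier3_zero[OF eqs(1-3)] fourier3_zero[OF eqs(4-6)]
    then have z: "h 1 = 0" "h 2 = 0" "h 3 = 0" unfolding h by simp_all
    then have "h 0 = 0" using sum by (simp add: sum_le_3)
    with z show "\<forall>i\<le>3. h i = 0" unfolding all_le_3 by simp
  qed
qed

subsection \<open>Uniqueness\<close>

text \<open>The diagonal matrix with entries 1, \<open>u\<close>, \<open>u^2\<close> generates
  \<open>diag3\<close> and has cube 1; carry it back along the diagonalization of
  \<open>H\<close>.\<close>

lemma classical_cartan_eq_span2:
  assumes "classical_cartan (H :: 'a m3 set)"
  obtains A where "A ** A ** A = mat 1" "H = span2 A"
proof -
  obtain P Q where PQ: "P ** Q = mat 1" "Q ** P = mat 1" and H: "conj3 P Q ` H = diag3"
    using classical_cartan_diagonalizable[OF assms two three] .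
  let ?L = "mat3 1 0 0 0 u 0 0 0 (u^2)"
  have "conj3 Q P ` conj3 P Q ` H = H"
    by (simp add: image_image conj3_inverse[OF PQ(2)])
  then have "H = span2 (conj3 Q P ?L)"
    by (simp add: H diag3_eq_span2 span2_image[OF PQ(1)])
  moreover have "conj3 Q P ?L ** conj3 Q P ?L ** conj3 Q P ?L = mat 1"
    by (simp add: L_cubed flip: conj3_mult[OF PQ(1)]) (simp add: conj3_def PQ)
  ultimately show ?thesis using that by blast
qed

text \<open>For traceless \<open>x\<close>, pairing with \<open>coweight i\<close> gives 18 times
  the diagonal entry, and 18 is nonzero.\<close>

lemma diagonal_zero_of_orthogonal:
  fixes x :: "'a m3"
  assumes "x \<in> sl3" "\<And>d. d \<in> diag3 \<Longrightarrow> killing x d = 0"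
  shows "x $ i $ i = 0"
proof -
  have n: "(18::'a) \<noteq> 0"
    using two three mult_eq_0_iff[of "2::'a" 3] mult_eq_0_iff[of "6::'a" 3] by simp
  have "killing x (coweight i) = 6 * (3 * x $ i $ i - trace x)" for i
  proof -
    have "\<forall>i. killing x (coweight i) = 6 * (3 * x $ i $ i - trace x)"
      unfolding forall_index3
      by (simp add: killing_def trace_def sum_index3 matrix_mult_nth3 coweight_nth algebra_simps)
    then show ?thesis by blast
  qed
  then show ?thesis
    using assms(1) assms(2)[OF coweight_mem_diag3, of i] n by (simp add: sl3_def)
qed

text \<open>Both \<open>A\<close> and \<open>A ** A\<close> have zero diagonal. For the square this
  kills every product of two opposite entries of \<open>A\<close>, while the cube being 1 makes one
  of the two cyclic products nonzero. So just one orientation survives.\<close>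

lemma orthogonal_to_diag3_eq_cyc_shift:
  assumes H: "H = span2 A" "A ** A ** A = mat 1" "H \<subseteq> sl3"
    and orth: "\<And>x d. x \<in> H \<Longrightarrow> d \<in> diag3 \<Longrightarrow> killing x d = (0::'a)"
  obtains a d e where "a * d * e = 1" "H = span2 (cyc_shift a d e)"
proof -
  have "A \<in> H" "A ** A \<in> H" using generators_mem_span2 by (simp_all add: H(1))
  then have diag: "A $ i $ i = 0" "(A ** A) $ i $ i = 0" for i
    using H(3) orth by (auto intro!: diagonal_zero_of_orthogonal)
  define a b c d e f where abc: "a = A $ 0 $ 1" "b = A $ 0 $ 2" "c = A $ 1 $ 0" "d = A $ 1 $ 2" "e = A $ 2 $ 0" "f = A $ 2 $ 1"
  have A: "A = mat3 0 a b c 0 d e f 0"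
    by (simp add: m3_eq_iff mat3_nth diag abc)
  have s: "a * c + b * e = 0" "a * c + d * f = 0" "b * e + d * f = 0"
    using diag(2)[of 0] diag(2)[of 1] diag(2)[of 2]
    by (simp_all add: A matrix_mult_nth3 mat3_nth mult.commute)
  have "2 * (a * c) = 0" "2 * (b * e) = 0" "2 * (d * f) = 0"
    using s by algebra+
  then have z: "a * c = 0" "b * e = 0" "d * f = 0" using two by simp_all
  have "(A ** A ** A) $ 0 $ 0 = 1" by (simp add: H(2) mat_def)
  then have det: "a * d * e + b * c * f = 1"
    by (simp add: A matrix_mult_nth3 mat3_nth algebra_simps)
  show ?thesis
  proof (cases "a = 0")
    case False
    then have "c = 0" using z by simp
    then have "a * d * e = 1" using det by simp
    moreover from this have "d \<noteq> 0" "e \<noteq> 0" by auto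
    then have "b = 0" "f = 0" using z by simp_all
    ultimately show ?thesis using that[of a d e] H(1) A \<open>c = 0\<close> by (simp add: cyc_shift_def)
  next
    case True
    then have det: "b * c * f = 1" using det by simp
    then have "b \<noteq> 0" "f \<noteq> 0" by auto
    then have "d = 0" "e = 0" using z by simp_all
    \<comment> \<open>In the opposite orientation the square has the desired one and spans the same
      plane.\<close>
    then have "A ** A = cyc_shift (b * f) (c * b) (f * c)"
      using True by (simp add: A m3_eq_iff cyc_shift_def matrix_mult_nth3 mat3_nth)
    moreover have "(b * f) * (c * b) * (f * c) = 1"
      using det by algebra
    ultimately show ?thesis using that H span2_square by metis
  qed
qed

lemma conj3_conj3: "conj3 P Q (conj3 P' Q' x) = conj3 (P ** P') (Q' ** Q) x"
  for P Q P' Q' x :: "'a m3"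
  by (simp add: conj3_def matrix_mul_assoc)

lemma conj3_subset_sl3: "Q ** P = mat 1 \<Longrightarrow> H \<subseteq> sl3 \<Longrightarrow> conj3 P Q ` H \<subseteq> sl3"
  for P Q :: "'a m3"
  by auto

lemma classical_cartan_sl3: "classical_cartan H \<Longrightarrow> H \<subseteq> sl3" for H :: "'a m3 set"
  using classical_cartanD(1) by (auto simp: subalgebra_def)

lemma conj3_image_eq_cyc_shift:
  assumes H: "classical_cartan H" and QP: "Q ** P = mat 1"
    and orth: "\<And>x d. x \<in> conj3 P Q ` H \<Longrightarrow> d \<in> diag3 \<Longrightarrow> killing x d = (0::'a)"
  obtains a d e where "a * d * e = 1" "conj3 P Q ` H = span2 (cyc_shift a d e)"
proof -
  obtain A where A: "A ** A ** A = mat 1" "H = span2 A"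
    using classical_cartan_eq_span2[OF H] .
  have PQ: "P ** Q = mat 1" using QP by (simp add: matrix_left_right_inverse)
  show ?thesis
  proof (rule orthogonal_to_diag3_eq_cyc_shift[where A = "conj3 P Q A"])
    show "conj3 P Q ` H = span2 (conj3 P Q A)" by (simp add: A(2) span2_image[OF QP])
    show "conj3 P Q A ** conj3 P Q A ** conj3 P Q A = mat 1"
      by (simp add: A(1) flip: conj3_mult[OF QP]) (simp add: conj3_def PQ)
    show "conj3 P Q ` H \<subseteq> sl3" by (rule conj3_subset_sl3[OF QP classical_cartan_sl3[OF H]])
  qed (use orth that in blast)+
qed

text \<open>Once \<open>H\<close> is diagonal, \<open>H'\<close> is generated by a weighted cyclic
  matrix, and a diagonal conjugation scales the weights to 1 while fixing \<open>diag3\<close>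
  pointwise.\<close>

lemma normalize_two:
  assumes H: "classical_cartan H" "classical_cartan H'" and orth: "\<And>x y. x \<in> H' \<Longrightarrow> y \<in> H \<Longrightarrow> killing x y = (0::'a)"
  obtains P Q where "Q ** P = mat 1" "conj3 P Q ` H = diag3" "conj3 P Q ` H' = cyc_plane 1 1"
proof -
  obtain P Q where PQ: "P ** Q = mat 1" "Q ** P = mat 1" and D: "conj3 P Q ` H = diag3"
    using classical_cartan_diagonalizable[OF H(1) two three] .
  obtain a d e where ade: "a * d * e = 1" and M: "conj3 P Q ` H' = span2 (cyc_shift a d e)"
  proof (rule conj3_image_eq_cyc_shift[OF H(2) PQ(2)])
    fix x d :: "'a m3"
    assume "x \<in> conj3 P Q ` H'" "d \<in> diag3"
    then show "killing x d = 0"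
      using orth by (auto simp: killing_conj3[OF PQ(2)] simp flip: D)
  qed
  have nz: "a \<noteq> 0" "d \<noteq> 0" "e \<noteq> 0" using ade by auto
  \<comment> \<open>Conjugation multiplies entry \<open>(i, j)\<close> by the quotient of the
    diagonal entries \<open>i\<close> and \<open>j\<close> of \<open>T\<close>; the last weight
    becomes \<open>a * d * e\<close>, which is 1.\<close>
  define T where "T = mat3 1 0 0 0 a 0 0 0 (a * d)"
  define S where "S = mat3 1 0 0 0 (1 / a) 0 0 0 (1 / (a * d))"
  have ST: "S ** T = mat 1" "T ** S = mat 1"
    using nz by (simp_all add: S_def T_def m3_eq_iff matrix_mult_nth3 mat3_nth mat1_nth3)
  have "conj3 T S (cyc_shift a d e) = cyc_shift 1 1 1"
    using nz ade by (simp add: conj3_def S_def T_def cyc_shift_def m3_eq_iff matrix_mult_nth3 mat3_nth)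
  then have 1: "conj3 T S ` conj3 P Q ` H' = cyc_plane 1 1"
    by (simp add: M span2_image[OF ST(1)] cyc_plane_eq_span2)
  have fixed: "conj3 T S x = x" if "x \<in> diag3" for x
    using nz that by (simp add: conj3_def S_def T_def m3_eq_iff matrix_mult_nth3 mat3_nth diag3_iff)
  have "conj3 T S ` diag3 = diag3" by (simp add: fixed)
  then have 0: "conj3 T S ` conj3 P Q ` H = diag3" by (simp add: D)
  have 2: "(Q ** S) ** (T ** P) = mat 1"
  proof -
    have "(Q ** S) ** (T ** P) = Q ** (S ** T) ** P" by (simp add: matrix_mul_assoc)
    then show ?thesis by (simp add: ST PQ)
  qed
  show ?thesis
    by (rule that[OF 2]) (use 0 1 in \<open>simp_all add: image_image conj3_conj3\<close>)
qed

text \<open>Orthogonality to both generators of \<open>cyc_plane 1 1\<close> makes the first two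
  elementary symmetric functions of the weights zero. For the ratios \<open>l\<close>,
  \<open>m\<close> this gives \<open>l + m = - 1\<close> and \<open>l * m = 1\<close>, so they are
  the roots \<open>u\<close>, \<open>u^2\<close> of \<open>x^2 + x + 1\<close>.\<close>

lemma third_component:
  assumes H: "classical_cartan H" and QP: "Q ** P = mat 1"
    and orth: "\<And>x d. x \<in> conj3 P Q ` H \<Longrightarrow> d \<in> diag3 \<Longrightarrow> killing x d = (0::'a)"
      "\<And>x y. x \<in> conj3 P Q ` H \<Longrightarrow> y \<in> cyc_plane 1 1 \<Longrightarrow> killing x y = (0::'a)"
  shows "conj3 P Q ` H = cyc_plane u (u^2) \<or> conj3 P Q ` H = cyc_plane (u^2) u"
proof -
  obtain a d e where ade: "a * d * e = 1" and M: "conj3 P Q ` H = span2 (cyc_shift a d e)"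
    using conj3_image_eq_cyc_shift[OF H QP orth(1)] .
  have nz: "a \<noteq> 0" "d \<noteq> 0" "e \<noteq> 0" using ade by auto
  have n: "(6::'a) \<noteq> 0" using two three mult_eq_0_iff[of "2::'a" 3] by simp
  have "cyc_plane 1 1 = span2 (cyc_shift 1 1 (1::'a))" by (rule cyc_plane_eq_span2) simp_all
  then have "killing (cyc_shift a d e) (cyc_shift 1 1 1 ** cyc_shift 1 1 1) = 0" "killing (cyc_shift a d e ** cyc_shift a d e) (cyc_shift 1 1 1) = 0"
    using orth(2) generators_mem_span2 unfolding M by metis+
  then have "6 * (a + d + e) = 0" "6 * (a * d + d * e + e * a) = 0"
    by (simp_all add: killing_def trace_def sum_index3 matrix_mult_nth3 cyc_shift_def mat3_nth)
  then have s: "a + d + e = 0" "a * d + d * e + e * a = 0"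
    using n by (metis mult_eq_0_iff)+
  define l where "l = d / a"
  define m where "m = e / a"
  have d: "d = l * a" and e: "e = m * a" using nz by (simp_all add: l_def m_def)
  have "a * (1 + l + m) = 0" "(a * a) * (l + l * m + m) = 0"
    using s by (simp_all add: d e algebra_simps)
  then have lm: "1 + l + m = 0" "l + l * m + m = 0" using nz by simp_all
  have "(l - u) * (l - u^2) = 0"
    using lm u_sum by algebra
  then have "l = u \<and> m = u^2 \<or> l = u^2 \<and> m = u"
  proof -
    have "m = - 1 - l" using lm(1) by (simp add: eq_neg_iff_add_eq_0 algebra_simps)
    moreover have "u^2 = - 1 - u" using u2 by (simp add: power2_eq_square)
    ultimately show ?thesis using \<open>(l - u) * (l - u^2) = 0\<close> by auto
  qed
  moreover have "conj3 P Q ` H = cyc_plane l m" if "l * m = 1" "l * l = m" "m * m = l"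
  proof -
    have "cyc_shift a d e = smul a (cyc_shift 1 l m)"
      by (simp add: d e cyc_shift_def m3_eq_iff mat3_nth mult.commute)
    then have "span2 (cyc_shift a d e) = span2 (cyc_shift 1 l m)"
      using span2_rescale[of a "a * a" "cyc_shift 1 l m" "cyc_shift 1 l m ** cyc_shift 1 l m"] nz
      by (simp add: span2_def smul_mult_left smul_mult_right smul_smul)
    then show ?thesis using cyc_plane_eq_span2[OF that] M by simp
  qed
  moreover have "u * u^2 = 1" "u * u = u^2" "u^2 * u = 1" "u^2 * u^2 = u"
    using u3' by (simp_all add: power2_eq_square flip: mult.assoc)
  ultimately show ?thesis by metis
qed

text \<open>One conjugation normalizes \<open>H 0\<close> and \<open>H 1\<close>; under the same
  conjugation \<open>third_component\<close> places \<open>H 2\<close> and \<open>H 3\<close> among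
  the two remaining components.\<close>

lemma COD_conjugate_J3:
  assumes "is_COD (H :: nat \<Rightarrow> 'a m3 set)"
  shows "COD_conjugate H (J3 u)"
proof -
  have cl: "classical_cartan (H i)" if "i \<le> 3" for i
    using assms that unfolding is_COD_def by blast
  have orth: "killing x y = 0" if "i \<le> 3" "j \<le> 3" "i \<noteq> j" "x \<in> H i" "y \<in> H j" for i j x y
    using assms that unfolding is_COD_def by blast
  obtain P Q where QP: "Q ** P = mat 1" and H0: "conj3 P Q ` H 0 = diag3" and H1: "conj3 P Q ` H 1 = cyc_plane 1 1"
  proof (rule normalize_two)
    show "classical_cartan (H 0)" "classical_cartan (H 1)" by (simp_all add: cl)
    show "killing x y = 0" if "x \<in> H 1" "y \<in> H 0" for x y
      using that by (intro orth[of 1 0]) simp_all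
  qed
  have rest: "conj3 P Q ` H i = J3 u 2 \<or> conj3 P Q ` H i = J3 u 3" if i: "i = 2 \<or> i = 3" for i
    unfolding J3_eq
  proof (rule third_component[OF cl QP])
    show "i \<le> 3" using i by auto
    fix x assume "x \<in> conj3 P Q ` H i"
    then obtain h where h: "x = conj3 P Q h" "h \<in> H i" by blast
    show "killing x d = 0" if "d \<in> diag3" for d :: "'a m3"
      using that h i orth[of i 0] unfolding H0[symmetric] by (auto simp: killing_conj3[OF QP])
    show "killing x d = 0" if "d \<in> cyc_plane 1 1" for d :: "'a m3"
      using that h i orth[of i 1] unfolding H1[symmetric] by (auto simp: killing_conj3[OF QP])
  qed
  have "\<forall>i\<le>3. \<exists>j\<le>3. conj3 P Q ` H i = J3 u j"
    unfolding all_le_3 using H0 H1 rest[of 2] rest[of 3] J3_eq(1,2)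
    by (metis le_refl one_le_numeral zero_le numeral_le_iff semiring_norm(69,72))
  then obtain \<sigma> where "\<forall>i\<le>3. \<sigma> i \<le> 3 \<and> conj3 P Q ` H i = J3 u (\<sigma> i)" by metis
  then show ?thesis
    unfolding COD_conjugate_def using lie_automorphism_conj3[OF QP] by blast
qed

end

theorem theorem3p12:
  fixes u :: "'a::{field, finite}"
  assumes "CHAR('a) > 3"
    and "3 dvd (CARD('a) - 1)"
    and "u ^ 3 = 1" and "u \<noteq> 1"
  shows "is_COD (J3 u) \<and> (\<forall>H :: nat \<Rightarrow> 'a m3 set. is_COD H \<longrightarrow> COD_conjugate H (J3 u))"
proof -
  have "of_nat n \<noteq> (0::'a)" if "0 < n" "n \<le> 3" for n
    using assms(1) that nat_dvd_not_less[of n "CHAR('a)"] by (auto simp: of_nat_eq_0_iff_char_dvd)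
  from this[of 2] this[of 3] have "(2::'a) \<noteq> 0" "(3::'a) \<noteq> 0" by simp_all
  then interpret cube_root u
    by unfold_locales (use assms in auto)
  show ?thesis using is_COD_J3[OF assms(1)] COD_conjugate_J3 by blast
qed

end
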